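(* Let $X$, $\alpha$, $C$, $\lambda$, $n$, $r$, $X_{r:n}$, $f_p$ and $\xi_p$ be as in the context. Then for every $p\ge0$, $$\lim_{t\to\infty}\xi_p(t)=\infty\quad\text{almost surely}\qquad\text{and}\qquad\limsup_{t\to\infty}\,(\xi_p(t)-t)=0\quad\text{almost surely.}$$
   Context: $X=\{X(t):t\in\mathbb R_+\}$ is a stationary Gaussian process with almost surely continuous sample paths, $\mathbb E X(t)=0$, $\mathbb E X^2(t)=1$, whose correlation function $r(t)=\mathbb E X(t)X(0)$ satisfies: (i) $r(t)=1-C|t|^\alpha+o(|t|^\alpha)$ as $t\to0$, for some $0<\alpha\le2$ and $C>0$; (ii) $r^*(s):=\sup_{t\ge s}|r(t)|<1$ for each $s>0$; (iii) $r(t)=O(t^{-2\lambda})$ as $t\to\infty$, for some $\lambda>0$. For $n\ge1$, $X_1,\dots,X_n$ are mutually independent copies of $X$, and for an integer $1\le r\le n$ (not to be confused with the correlation function $r(\cdot)$), $X_{r:n}=\{X_{r:n}(t):t\ge0\}$ is the $r$th smallest order statistics process: for each $t\ge 0$, $X_{r:n}(t)$ is the $r$th smallest of $X_1(t),\dots,X_n(t)$, so that $X_{1:n}(t)=\min_j X_j(t)\le\dots\le X_{n:n}(t)=\max_j X_j(t)$. Put $\hat r=n-r+1$ and $\log_2 s=\log\log s$. For $p\in\mathbb R$, $$f_p(s)=\left(\frac{2}{\hat r}\left(\log s+\left(\frac{2-\hat r\alpha}{2\alpha}+1-p\right)\log_2 s\right)\right)^{1/2},$$ considered for $s\ge s_p$,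 where $s_p>e$ is fixed large enough that $f_p$ is well defined, positive and increasing on $[s_p,\infty)$. Define $$\xi_p(t)=\sup\{s: s_p\le s\le t,\ X_{r:n}(s)\ge f_p(s)\}$$ (with $\sup\emptyset=0$). *)

theory Defs
  imports "HOL-Probability.Probability" "HOL-Library.Landau_Symbols"
begin

text \<open>A real process is a curried function \<open>X t \<omega>\<close>; only times \<open>t \<ge> 0\<close> are ever used.\<close>

text \<open>Normal distributions, including the degenerate ones (point masses).\<close>

definition gaussian_rv :: "'a measure \<Rightarrow> ('a \<Rightarrow> real) \<Rightarrow> bool" where
  "gaussian_rv M Y \<longleftrightarrow>
     (\<exists>\<mu> \<sigma>. \<sigma> > 0 \<and> distributed M lborel Y (normal_density \<mu> \<sigma>)) \<or>
     (\<exists>\<mu>. Y \<in> borel_measurable M \<and> (AE \<omega> in M. Y \<omega> = \<mu>))"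

definition gaussian_process :: "'a measure \<Rightarrow> (real \<Rightarrow> 'a \<Rightarrow> real) \<Rightarrow> bool" where
  "gaussian_process M X \<longleftrightarrow>
     (\<forall>t\<ge>0. X t \<in> borel_measurable M) \<and>
     (\<forall>T a. finite T \<and> T \<subseteq> {0..} \<longrightarrow> gaussian_rv M (\<lambda>\<omega>. \<Sum>t\<in>T. a t * X t \<omega>))"

definition sample_path :: "(real \<Rightarrow> 'a \<Rightarrow> real) \<Rightarrow> 'a \<Rightarrow> (real \<Rightarrow> real)" where
  "sample_path X \<omega> = (\<lambda>t\<in>{0..}. X t \<omega>)"

abbreviation path_space :: "(real \<Rightarrow> real) measure" where
  "path_space \<equiv> Pi\<^sub>M {0..} (\<lambda>_. borel)"

text \<open>The law on the product \<open>\<sigma>\<close>-algebra is determined by the finite-dimensional distributions.\<close>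

definition process_law :: "'a measure \<Rightarrow> (real \<Rightarrow> 'a \<Rightarrow> real) \<Rightarrow> (real \<Rightarrow> real) measure" where
  "process_law M X = distr M path_space (sample_path X)"

definition stationary_process :: "'a measure \<Rightarrow> (real \<Rightarrow> 'a \<Rightarrow> real) \<Rightarrow> bool" where
  "stationary_process M X \<longleftrightarrow> (\<forall>h\<ge>0. process_law M (\<lambda>t. X (t + h)) = process_law M X)"

definition as_continuous_paths :: "'a measure \<Rightarrow> (real \<Rightarrow> 'a \<Rightarrow> real) \<Rightarrow> bool" where
  "as_continuous_paths M X \<longleftrightarrow> (AE \<omega> in M. continuous_on {0..} (\<lambda>t. X t \<omega>))"

definition corr_fun :: "'a measure \<Rightarrow> (real \<Rightarrow> 'a \<Rightarrow> real) \<Rightarrow> real \<Rightarrow> real" where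
  "corr_fun M X t = (\<integral>\<omega>. X t \<omega> * X 0 \<omega> \<partial>M)"

text \<open>Mutually independent copies of a process with almost surely continuous paths. Path
  continuity has to be required of the copies separately, as the set of continuous paths does
  not belong to the product \<open>\<sigma>\<close>-algebra.\<close>

definition independent_copies ::
  "'a measure \<Rightarrow> nat set \<Rightarrow> (nat \<Rightarrow> real \<Rightarrow> 'a \<Rightarrow> real) \<Rightarrow> 'b measure \<Rightarrow> (real \<Rightarrow> 'b \<Rightarrow> real) \<Rightarrow> bool"
where
  "independent_copies M J Xs N X \<longleftrightarrow>
     (\<forall>j\<in>J. (\<forall>t\<ge>0. Xs j t \<in> borel_measurable M) \<and>
             process_law M (Xs j) = process_law N X \<and>
             as_continuous_paths M (Xs j)) \<and>
     prob_space.indep_vars M (\<lambda>_. path_space) (\<lambda>j. sample_path (Xs j)) J"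

definition order_stat ::
  "nat \<Rightarrow> nat \<Rightarrow> (nat \<Rightarrow> real \<Rightarrow> 'a \<Rightarrow> real) \<Rightarrow> real \<Rightarrow> 'a \<Rightarrow> real" where
  "order_stat r n Xs t \<omega> = sort (map (\<lambda>j. Xs j t \<omega>) [1..<n + 1]) ! (r - 1)"

definition level_fun :: "real \<Rightarrow> nat \<Rightarrow> nat \<Rightarrow> real \<Rightarrow> real \<Rightarrow> real" where
  "level_fun \<alpha> r n p s =
     (let rh = real (n - r + 1) in
      sqrt (2 / rh * (ln s + ((2 - rh * \<alpha>) / (2 * \<alpha>) + 1 - p) * ln (ln s))))"

text \<open>The last time in \<open>[s0, t]\<close> at which the path \<open>y\<close> is at or above the level \<open>f\<close>,
  and \<open>0\<close> if there is none.\<close>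

definition last_exceedance :: "(real \<Rightarrow> real) \<Rightarrow> real \<Rightarrow> (real \<Rightarrow> real) \<Rightarrow> real \<Rightarrow> real" where
  "last_exceedance f s0 y t =
     (let S = {s. s0 \<le> s \<and> s \<le> t \<and> y s \<ge> f s} in if S = {} then 0 else Sup S)"

end

theory Submission
  imports Defs "HOL-Real_Asymp.Real_Asymp"
begin

text \<open>Why the theorem holds. A path whose exceedance times are unbounded has both
properties: \<open>\<xi> t \<le> t\<close> always, with equality at every exceedance time. So it suffices that
almost surely the order statistic process is above the level at arbitrarily late times
(\<open>last_exceedance_unbounded\<close>). Put \<open>m = n - r + 1\<close>. If the first \<open>m\<close> copies all exceed a level
at time \<open>t\<close>, then so does the \<open>r\<close>th smallest of the \<open>n\<close> copies (\<open>order_stat_ge\<close>), and by independence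
this happens with probability \<open>normal_tail u ^ m\<close>. The level decreases with \<open>p\<close>, hence \<open>p = 0\<close> is the
critical case.

It is enough to look at a discrete set of times. In the \<open>k\<close>th block, a part of the interval from
\<open>3/4 * exp k\<close> to \<open>exp k\<close>, the times are spaced by \<open>k powr (- 1 / \<alpha>)\<close>, and the level is held at
its value for \<open>p = 0\<close> at the right end \<open>exp k\<close>. The squared level \<open>u\<^sup>2\<close> is of order \<open>k\<close>, and
an excursion above it lasts for a time \<open>h\<close> with \<open>u\<^sup>2 * h powr \<alpha>\<close> of order 1, which is the spacing:
an exceedance is followed by boundedly many others on average, while a coarser grid would lose a power of \<open>k\<close>
in the number of exceedances. With this spacing, the expected
number of grid points of block \<open>k\<close> at which all \<open>m\<close> copies exceed the level is of the exact order
\<open>1 / k\<close> (\<open>block_expectation_bounds\<close>); its sum diverges, but only just.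

Let \<open>Z k\<close> be that number. The blocks are treated by Chebyshev's inequality
(\<open>infinitely_often_by_second_moment\<close>), which needs two estimates of joint tails of a pair of standard normal
variables with correlation \<open>\<rho>\<close>. Within a block the second moment of \<open>Z k\<close> is at most a constant times its
mean: since both variables are above \<open>u\<close> only if their sum is above \<open>2 * u\<close>, the joint tail gains a
factor \<open>exp (- u\<^sup>2 * (1 - \<rho>) / 4)\<close> over the single tail (\<open>pair_tail_near\<close>), which is summable over the
grid by the local behaviour of the correlation, and beyond small powers of \<open>exp k\<close> the variables are
almost independent. For different blocks the pair is asymptotically independent with ratio tending to 1
(\<open>pair_tail_far\<close>), because the polynomial decay of the correlation beats the logarithmic growth of
the squared levels. The ratio has to tend to 1, as otherwise the second moment method would give an
exceedance only with positive probability.\<close>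

section \<open>The standard normal tail\<close>

definition normal_tail :: "real \<Rightarrow> real" where
  "normal_tail u = measure std_normal_distribution {u..}"

interpretation std_normal: prob_space std_normal_distribution
  by (rule prob_space_normal_density) simp

lemma emeasure_std_normal:
  "A \<in> sets borel \<Longrightarrow>
   emeasure std_normal_distribution A = (\<integral>\<^sup>+x. ennreal (std_normal_density x) * indicator A x \<partial>lborel)"
  by (simp add: emeasure_density)

lemma normal_tail_nonneg: "0 \<le> normal_tail u"
  by (simp add: normal_tail_def)

lemma normal_tail_antimono: "u \<le> v \<Longrightarrow> normal_tail v \<le> normal_tail u"
  unfolding normal_tail_def by (intro std_normal.finite_measure_mono) auto

lemma std_normal_density_antimono:
  assumes "0 \<le> u" "u \<le> v"
  shows "std_normal_density v \<le> std_normal_density u"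
proof -
  have "u\<^sup>2 \<le> v\<^sup>2" using assms by (intro power_mono) auto
  then show ?thesis
    unfolding std_normal_density_def by (intro mult_left_mono) auto
qed

text \<open>On \<open>{u..}\<close> the density is at most \<open>x / u\<close> times itself, and \<open>x\<close> times the density has
minus the density as antiderivative.\<close>

lemma normal_tail_upper:
  assumes "0 < u"
  shows "normal_tail u \<le> std_normal_density u / u"
proof -
  let ?F = "\<lambda>x. - std_normal_density x / u"
  have "ennreal (normal_tail u) = (\<integral>\<^sup>+x. ennreal (std_normal_density x) * indicator {u..} x \<partial>lborel)"
    unfolding normal_tail_def
    by (subst std_normal.emeasure_eq_measure[symmetric], subst emeasure_std_normal) auto
  also have "\<dots> \<le> (\<integral>\<^sup>+x. ennreal (x / u * std_normal_density x) * indicator {u..} x \<partial>lborel)"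
  proof (rule nn_integral_mono)
    fix x
    show "ennreal (std_normal_density x) * indicator {u..} x
      \<le> ennreal (x / u * std_normal_density x) * indicator {u..} x"
    proof (cases "u \<le> x")
      case True
      have "1 * std_normal_density x \<le> x / u * std_normal_density x"
        using True assms by (intro mult_right_mono) auto
      then show ?thesis using True by (simp add: ennreal_leI)
    qed simp
  qed
  also have "\<dots> = 0 - ?F u"
  proof (rule nn_integral_FTC_atLeast[where F = "?F"])
    show "DERIV ?F x :> x / u * std_normal_density x" for x
      unfolding std_normal_density_def using assms
      by (auto intro!: derivative_eq_intros simp: field_simps)
    show "0 \<le> x / u * std_normal_density x" if "u \<le> x" for x
      using assms that by simp
    show "(?F \<longlongrightarrow> 0) at_top"
      unfolding std_normal_density_def using assms by real_asymp
  qed simp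
  finally show ?thesis
    using assms by (simp add: ennreal_le_iff)
qed

lemma normal_tail_interval_bounds:
  assumes "0 \<le> a" "a \<le> b"
  shows "normal_tail a \<le> normal_tail b + (b - a) * std_normal_density a"
    and "(b - a) * std_normal_density b \<le> normal_tail a"
proof -
  let ?m = "measure std_normal_distribution"
  have "{a..} = {a..<b} \<union> {b..}" "{a..<b} \<inter> {b..} = {}" using assms by auto
  then have eq: "normal_tail a = ?m {a..<b} + normal_tail b"
    unfolding normal_tail_def by (simp add: std_normal.finite_measure_Union)
  have m: "ennreal (?m {a..<b})
      = (\<integral>\<^sup>+x. ennreal (std_normal_density x) * indicator {a..<b} x \<partial>lborel)"
    by (subst std_normal.emeasure_eq_measure[symmetric], subst emeasure_std_normal) auto
  have "ennreal (?m {a..<b}) \<le> (\<integral>\<^sup>+x. ennreal (std_normal_density a) * indicator {a..<b} x \<partial>lborel)"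
    unfolding m using assms
    by (intro nn_integral_mono) (auto split: split_indicator intro!: ennreal_leI std_normal_density_antimono)
  also have "\<dots> = ennreal ((b - a) * std_normal_density a)"
    using assms by (simp add: nn_integral_cmult_indicator ennreal_mult'[symmetric] mult.commute)
  finally have le: "?m {a..<b} \<le> (b - a) * std_normal_density a"
    using assms by (simp add: ennreal_le_iff)
  then show "normal_tail a \<le> normal_tail b + (b - a) * std_normal_density a"
    using eq by simp
  have "ennreal ((b - a) * std_normal_density b)
      = (\<integral>\<^sup>+x. ennreal (std_normal_density b) * indicator {a..<b} x \<partial>lborel)"
    using assms by (simp add: nn_integral_cmult_indicator ennreal_mult'[symmetric] mult.commute)
  also have "\<dots> \<le> ennreal (?m {a..<b})"
    unfolding m using assms
    by (intro nn_integral_mono) (auto split: split_indicator intro!: ennreal_leI std_normal_density_antimono)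
  finally have "(b - a) * std_normal_density b \<le> ?m {a..<b}"
    by (simp add: ennreal_le_iff)
  then show "(b - a) * std_normal_density b \<le> normal_tail a"
    using eq normal_tail_nonneg[of b] by simp
qed

text \<open>The density changes only by a constant factor between \<open>u\<close> and \<open>u + 1 / u\<close>, so this interval
alone has the mass of the upper bound, up to that factor.\<close>

lemma normal_tail_lower:
  assumes "1 \<le> u"
  shows "exp (- 3 / 2) * (std_normal_density u / u) \<le> normal_tail u"
proof -
  have "exp (- 3 / 2) * std_normal_density u \<le> std_normal_density (u + 1 / u)"
  proof -
    have "(1 / u)\<^sup>2 \<le> 1" using assms by (simp add: power_le_one)
    moreover have "(u + 1 / u)\<^sup>2 = u\<^sup>2 + 2 + (1 / u)\<^sup>2"
      using assms by (simp add: power2_sum)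
    ultimately have "- 3 / 2 + - u\<^sup>2 / 2 \<le> - (u + 1 / u)\<^sup>2 / 2" by simp
    then have "exp (- 3 / 2) * exp (- u\<^sup>2 / 2) \<le> exp (- (u + 1 / u)\<^sup>2 / 2)"
      by (simp only: exp_add[symmetric] exp_le_cancel_iff)
    then have "(1 / sqrt (2 * pi)) * (exp (- 3 / 2) * exp (- u\<^sup>2 / 2))
        \<le> (1 / sqrt (2 * pi)) * exp (- (u + 1 / u)\<^sup>2 / 2)"
      by (intro mult_left_mono) auto
    then show ?thesis
      unfolding std_normal_density_def by (simp only: mult_ac)
  qed
  then have "1 / u * (exp (- 3 / 2) * std_normal_density u) \<le> 1 / u * std_normal_density (u + 1 / u)"
    using assms by (intro mult_left_mono) auto
  also have "\<dots> \<le> normal_tail u"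
    using normal_tail_interval_bounds(2)[of u "u + 1 / u"] assms by simp
  finally show ?thesis by simp
qed

lemma std_normal_density_le_tail:
  assumes "1 \<le> u"
  shows "std_normal_density u \<le> exp (3 / 2) * u * normal_tail u"
proof -
  have "exp (3/2) * u * (exp (- 3 / 2) * (std_normal_density u / u)) \<le> exp (3/2) * u * normal_tail u"
    using assms by (intro mult_left_mono normal_tail_lower) auto
  moreover have "exp (3/2) * u * (exp (- 3 / 2) * (std_normal_density u / u)) = std_normal_density u"
    using assms by (simp add: exp_minus field_simps)
  ultimately show ?thesis by simp
qed

text \<open>A shift of the level is harmless as soon as it is small compared with \<open>1 / v\<close>.\<close>

lemma normal_tail_shift:
  assumes "1 \<le> v" "0 \<le> \<eta>" "\<eta> \<le> v"
  shows "normal_tail (v - \<eta>) \<le> (1 + exp (3 / 2) * (\<eta> * v) * exp (\<eta> * v)) * normal_tail v"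
proof -
  have "std_normal_density (v - \<eta>) \<le> exp (\<eta> * v) * std_normal_density v"
  proof -
    have "- (v - \<eta>)\<^sup>2 / 2 \<le> \<eta> * v + - v\<^sup>2 / 2"
      by (simp add: power2_diff field_simps)
    then have "exp (- (v - \<eta>)\<^sup>2 / 2) \<le> exp (\<eta> * v) * exp (- v\<^sup>2 / 2)"
      by (simp only: exp_add[symmetric] exp_le_cancel_iff)
    then have "(1 / sqrt (2 * pi)) * exp (- (v - \<eta>)\<^sup>2 / 2)
       \<le> (1 / sqrt (2 * pi)) * (exp (\<eta> * v) * exp (- v\<^sup>2 / 2))"
      by (intro mult_left_mono) auto
    then show ?thesis
      unfolding std_normal_density_def by (simp only: mult_ac)
  qed
  also have "\<dots> \<le> exp (\<eta> * v) * (exp (3 / 2) * v * normal_tail v)"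
    using assms by (intro mult_left_mono std_normal_density_le_tail) auto
  finally have "\<eta> * std_normal_density (v - \<eta>) \<le> \<eta> * (exp (\<eta> * v) * (exp (3 / 2) * v * normal_tail v))"
    using assms by (intro mult_left_mono) auto
  with normal_tail_interval_bounds(1)[of "v - \<eta>" v] assms
  show ?thesis by (simp add: algebra_simps)
qed

lemma normal_tail_gain:
  assumes "1 \<le> u" "u \<le> w" "u\<^sup>2 + d \<le> w\<^sup>2"
  shows "normal_tail w \<le> exp (3 / 2) * normal_tail u * exp (- d / 2)"
proof -
  have "normal_tail w \<le> std_normal_density w / w"
    using assms by (intro normal_tail_upper) auto
  also have "\<dots> \<le> std_normal_density w / u"
    using assms by (intro divide_left_mono) auto
  also have "\<dots> \<le> (std_normal_density u * exp (- d / 2)) / u"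
  proof -
    have "- w\<^sup>2 / 2 \<le> - u\<^sup>2 / 2 + - d / 2" using assms by simp
    then have "exp (- w\<^sup>2 / 2) \<le> exp (- u\<^sup>2 / 2) * exp (- d / 2)"
      by (simp only: exp_add[symmetric] exp_le_cancel_iff)
    then have "(1 / sqrt (2 * pi)) * exp (- w\<^sup>2 / 2)
       \<le> (1 / sqrt (2 * pi)) * (exp (- u\<^sup>2 / 2) * exp (- d / 2))"
      by (intro mult_left_mono) auto
    then have "std_normal_density w \<le> std_normal_density u * exp (- d / 2)"
      unfolding std_normal_density_def by (simp only: mult_ac)
    then show ?thesis using assms by (intro divide_right_mono) auto
  qed
  also have "\<dots> \<le> (exp (3 / 2) * u * normal_tail u) * exp (- d / 2) / u"
    using assms std_normal_density_le_tail[of u]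
    by (intro divide_right_mono mult_right_mono) auto
  also have "\<dots> = exp (3 / 2) * normal_tail u * exp (- d / 2)"
    using assms by simp
  finally show ?thesis .
qed

text \<open>The tail beyond \<open>3 * L\<close> is of order \<open>exp (- 9/2 * L\<^sup>2)\<close> and thus negligible against
a product of two tails at levels up to \<open>L\<close>, which is of order \<open>exp (- L\<^sup>2)\<close>. This allows a
truncation in the bound for joint tails.\<close>

lemma normal_tail_triple:
  assumes "0 < (\<epsilon>::real)"
  shows "eventually (\<lambda>L. normal_tail (3 * L) \<le> \<epsilon> * (normal_tail L)\<^sup>2) at_top"
proof -
  define c :: real where "c = 1 / sqrt (2 * pi)"
  have "c > 0" by (simp add: c_def)
  have "((\<lambda>L. exp (- (3 * L)\<^sup>2 / 2) * (c / (3 * L))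
      / ((exp (- L\<^sup>2 / 2))\<^sup>2 * ((c * (exp (- 3 / 2) / L))\<^sup>2 * \<epsilon>))) \<longlongrightarrow> 0) at_top"
    using \<open>c > 0\<close> \<open>\<epsilon> > 0\<close> by real_asymp
  then have "eventually (\<lambda>L. exp (- (3 * L)\<^sup>2 / 2) * (c / (3 * L))
      / ((exp (- L\<^sup>2 / 2))\<^sup>2 * ((c * (exp (- 3 / 2) / L))\<^sup>2 * \<epsilon>)) < 1) at_top"
    by (rule order_tendstoD) simp
  with eventually_gt_at_top[of 0]
  have e: "eventually (\<lambda>L. exp (- (3 * L)\<^sup>2 / 2) * (c / (3 * L))
      \<le> (exp (- L\<^sup>2 / 2))\<^sup>2 * ((c * (exp (- 3 / 2) / L))\<^sup>2 * \<epsilon>)) at_top"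
  proof eventually_elim
    case (elim L)
    have "(exp (- L\<^sup>2 / 2))\<^sup>2 * ((c * (exp (- 3 / 2) / L))\<^sup>2 * \<epsilon>) > 0"
      using \<open>c > 0\<close> \<open>\<epsilon> > 0\<close> elim by simp
    with elim(2) show ?case by (simp only: divide_less_eq_1_pos)
  qed
  show ?thesis using e eventually_ge_at_top[of 1]
  proof eventually_elim
    case (elim L)
    have "normal_tail (3 * L) \<le> std_normal_density (3 * L) / (3 * L)"
      using elim by (intro normal_tail_upper) auto
    also have "\<dots> = exp (- (3 * L)\<^sup>2 / 2) * (c / (3 * L))"
      by (simp add: std_normal_density_def c_def)
    also note elim(1)
    also have "(exp (- L\<^sup>2 / 2))\<^sup>2 * ((c * (exp (- 3 / 2) / L))\<^sup>2 * \<epsilon>) =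
       \<epsilon> * (exp (- 3 / 2) * (std_normal_density L / L))\<^sup>2"
      by (simp add: std_normal_density_def c_def power_mult_distrib power_divide field_simps)
    also have "\<dots> \<le> \<epsilon> * (normal_tail L)\<^sup>2"
      using elim assms normal_tail_lower[of L]
      by (intro mult_left_mono power_mono) auto
    finally show ?case .
  qed
qed

text \<open>The bound of \<open>bivariate_tail_far\<close> below is, for levels up to \<open>L\<close> and correlation small
compared with \<open>1 / L\<^sup>2\<close>, the product of the tails up to a factor close to 1.\<close>

lemma far_tail_bound:
  assumes "0 < (\<epsilon>::real)"
  obtains L0 \<eta>0 where "1 \<le> L0" "0 < \<eta>0"
    "\<And>L u v \<rho>. L0 \<le> L \<Longrightarrow> 1 \<le> u \<Longrightarrow> u \<le> L \<Longrightarrow> 1 \<le> v \<Longrightarrow> v \<le> L \<Longrightarrow> \<bar>\<rho>\<bar> * L\<^sup>2 \<le> \<eta>0 \<Longrightarrow>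
       3 * \<bar>\<rho>\<bar> * L \<le> v \<and>
       normal_tail u * normal_tail (v - 3 * \<bar>\<rho>\<bar> * L) + normal_tail (3 * L)
       \<le> (1 + \<epsilon>) * (normal_tail u * normal_tail v)"
proof -
  from normal_tail_triple[of "\<epsilon> / 2"] assms obtain L1 where
    L1: "\<And>L. L1 \<le> L \<Longrightarrow> normal_tail (3 * L) \<le> \<epsilon> / 2 * (normal_tail L)\<^sup>2"
    by (auto simp: eventually_at_top_linorder)
  define \<eta>0 where "\<eta>0 = min (1 / 3) (\<epsilon> / (6 * exp (5 / 2)))"
  have \<eta>0: "0 < \<eta>0" "\<eta>0 \<le> 1 / 3" "exp (5 / 2) * (3 * \<eta>0) \<le> \<epsilon> / 2"
    using assms by (auto simp: \<eta>0_def min_def field_simps)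
  show ?thesis
  proof (rule that[of "max 1 L1" \<eta>0])
    fix L u v \<rho> :: real
    assume *: "max 1 L1 \<le> L" "1 \<le> u" "u \<le> L" "1 \<le> v" "v \<le> L" "\<bar>\<rho>\<bar> * L\<^sup>2 \<le> \<eta>0"
    define \<eta> where "\<eta> = 3 * \<bar>\<rho>\<bar> * L"
    have "0 \<le> \<eta>" using * by (simp add: \<eta>_def)
    have "\<eta> * v \<le> \<eta> * L" using \<open>0 \<le> \<eta>\<close> * by (intro mult_left_mono) auto
    also have "\<dots> \<le> 3 * \<eta>0" using *(6) by (simp add: \<eta>_def power2_eq_square)
    finally have \<eta>v: "\<eta> * v \<le> 3 * \<eta>0" .
    have "\<eta> * 1 \<le> \<eta> * v" using \<open>0 \<le> \<eta>\<close> * by (intro mult_left_mono) auto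
    with \<eta>v \<eta>0 * have "\<eta> \<le> v" by linarith
    have nn: "0 \<le> \<eta> * v" using \<open>0 \<le> \<eta>\<close> * by simp
    have "x * exp x \<le> (3 * \<eta>0) * exp 1" if "0 \<le> x" "x \<le> 1" "x \<le> 3 * \<eta>0" for x
      using that by (intro mult_mono) auto
    from this[of "\<eta> * v"] have "(\<eta> * v) * exp (\<eta> * v) \<le> (3 * \<eta>0) * exp 1"
      using \<eta>v \<eta>0(2) nn by simp
    then have "exp (3 / 2) * (\<eta> * v) * exp (\<eta> * v) \<le> exp (3 / 2) * (3 * \<eta>0) * exp 1"
      by (simp only: mult.assoc mult_le_cancel_left_pos exp_gt_zero)
    also have "\<dots> = exp (5 / 2) * (3 * \<eta>0)"
      using exp_add[of "3/2 :: real" 1] by simp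
    finally have "exp (3 / 2) * (\<eta> * v) * exp (\<eta> * v) \<le> \<epsilon> / 2" using \<eta>0 by linarith
    then have "normal_tail (v - \<eta>) \<le> (1 + \<epsilon> / 2) * normal_tail v"
      using normal_tail_shift[OF \<open>1 \<le> v\<close> \<open>0 \<le> \<eta>\<close> \<open>\<eta> \<le> v\<close>]
      by (rule_tac order_trans) (auto intro!: mult_right_mono normal_tail_nonneg)
    then have "normal_tail u * normal_tail (v - \<eta>) \<le> normal_tail u * ((1 + \<epsilon> / 2) * normal_tail v)"
      by (intro mult_left_mono normal_tail_nonneg)
    moreover have "normal_tail (3 * L) \<le> \<epsilon> / 2 * (normal_tail u * normal_tail v)"
    proof -
      have "(normal_tail L)\<^sup>2 \<le> normal_tail u * normal_tail v"
        unfolding power2_eq_square using * by (intro mult_mono normal_tail_antimono normal_tail_nonneg)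
      then have "\<epsilon> / 2 * (normal_tail L)\<^sup>2 \<le> \<epsilon> / 2 * (normal_tail u * normal_tail v)"
        using assms by (intro mult_left_mono) auto
      with L1[of L] * show ?thesis by simp
    qed
    ultimately show "3 * \<bar>\<rho>\<bar> * L \<le> v \<and>
       normal_tail u * normal_tail (v - 3 * \<bar>\<rho>\<bar> * L) + normal_tail (3 * L)
       \<le> (1 + \<epsilon>) * (normal_tail u * normal_tail v)"
      using \<open>\<eta> \<le> v\<close> by (simp add: \<eta>_def algebra_simps)
  qed (use \<eta>0 in auto)
qed

section \<open>Pairs of jointly normal random variables\<close>

context prob_space begin

lemma gaussian_rv_standardize:
  assumes "gaussian_rv M Y" "expectation Y = 0" "expectation (\<lambda>\<omega>. (Y \<omega>)\<^sup>2) = V" "V > 0"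
  shows "Y \<in> borel_measurable M"
    and "distr M borel (\<lambda>\<omega>. Y \<omega> / sqrt V) = std_normal_distribution"
proof -
  from assms(1) consider
      (normal) \<mu> \<sigma> where "\<sigma> > 0" "distributed M lborel Y (normal_density \<mu> \<sigma>)"
    | (const) \<mu> where "Y \<in> borel_measurable M" "AE \<omega> in M. Y \<omega> = \<mu>"
    unfolding gaussian_rv_def by blast
  then have "Y \<in> borel_measurable M \<and> distr M borel (\<lambda>\<omega>. Y \<omega> / sqrt V) = std_normal_distribution"
  proof cases
    case normal
    have "\<mu> = 0"
      using normal_distributed_expectation[OF normal] assms by simp
    have "\<sigma>\<^sup>2 = V"
      using normal_distributed_variance[OF normal] assms by simp
    then have "sqrt V = \<sigma>" using normal by auto
    have "distributed M lborel (\<lambda>\<omega>. (Y \<omega> - \<mu>) / \<sigma>) std_normal_density"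
      using normal normal_standard_normal_convert[of \<sigma> Y \<mu>] by blast
    then have d: "distributed M lborel (\<lambda>\<omega>. Y \<omega> / sqrt V) std_normal_density"
      using \<open>\<mu> = 0\<close> \<open>sqrt V = \<sigma>\<close> by simp
    have "distr M borel (\<lambda>\<omega>. Y \<omega> / sqrt V) = distr M lborel (\<lambda>\<omega>. Y \<omega> / sqrt V)"
      by (rule distr_cong) auto
    also have "\<dots> = std_normal_distribution"
      using d by (simp add: distributed_def)
    finally show ?thesis using normal by (auto simp: distributed_def)
  next
    case const
    have "expectation Y = expectation (\<lambda>_. \<mu>)"
      using const by (intro integral_cong_AE) auto
    then have "\<mu> = 0" using assms by (simp add: prob_space)
    have "expectation (\<lambda>\<omega>. (Y \<omega>)\<^sup>2) = expectation (\<lambda>_. 0)"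
      using const \<open>\<mu> = 0\<close> by (intro integral_cong_AE) auto
    with assms show ?thesis by simp
  qed
  then show "Y \<in> borel_measurable M"
    and "distr M borel (\<lambda>\<omega>. Y \<omega> / sqrt V) = std_normal_distribution" by auto
qed

lemma gaussian_rv_tail:
  assumes "gaussian_rv M Y" "expectation Y = 0" "expectation (\<lambda>\<omega>. (Y \<omega>)\<^sup>2) = V" "V > 0"
  shows "prob {\<omega>\<in>space M. a \<le> Y \<omega>} = normal_tail (a / sqrt V)"
proof -
  note [measurable] = gaussian_rv_standardize(1)[OF assms]
  have "normal_tail (a / sqrt V) = measure (distr M borel (\<lambda>\<omega>. Y \<omega> / sqrt V)) {a / sqrt V..}"
    by (simp add: normal_tail_def gaussian_rv_standardize(2)[OF assms])
  also have "\<dots> = prob ((\<lambda>\<omega>. Y \<omega> / sqrt V) -` {a / sqrt V..} \<inter> space M)"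
    by (subst measure_distr) auto
  also have "(\<lambda>\<omega>. Y \<omega> / sqrt V) -` {a / sqrt V..} \<inter> space M = {\<omega>\<in>space M. a \<le> Y \<omega>}"
    using \<open>V > 0\<close> by (auto simp: divide_le_cancel)
  finally show ?thesis by simp
qed

lemma gaussian_rv_char:
  assumes "gaussian_rv M Y" "expectation Y = 0" "expectation (\<lambda>\<omega>. (Y \<omega>)\<^sup>2) = V" "V > 0"
  shows "(CLINT \<omega>|M. iexp (Y \<omega>)) = of_real (exp (- V / 2))"
proof -
  note [measurable] = gaussian_rv_standardize(1)[OF assms]
  have "(CLINT \<omega>|M. iexp (Y \<omega>)) = (CLINT \<omega>|M. iexp (sqrt V * (Y \<omega> / sqrt V)))"
    using \<open>V > 0\<close> by simp
  also have "\<dots> = char (distr M borel (\<lambda>\<omega>. Y \<omega> / sqrt V)) (sqrt V)"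
    unfolding char_def by (subst integral_distr) auto
  also have "\<dots> = of_real (exp (- V / 2))"
    using \<open>V > 0\<close> by (simp add: gaussian_rv_standardize(2)[OF assms] char_std_normal_distribution)
  finally show ?thesis .
qed

text \<open>Uniqueness of characteristic functions on the line, for the law of \<open>X\<close> under the probability
measure with density \<open>g / c\<close>. Applied with different \<open>g\<close> it yields statements about pairs of random
variables without characteristic functions in the plane.\<close>

lemma tilted_std_normal:
  fixes X g :: "'a \<Rightarrow> real"
  assumes [measurable]: "X \<in> borel_measurable M" "g \<in> borel_measurable M"
    and g: "\<And>\<omega>. 0 \<le> g \<omega>" "\<And>\<omega>. g \<omega> \<le> K" and "0 < c"
    and char: "\<And>s. (CLINT \<omega>|M. of_real (g \<omega>) * iexp (s * X \<omega>)) = of_real (c * exp (- s\<^sup>2 / 2))"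
    and [measurable]: "A \<in> sets borel"
  shows "(\<integral>\<omega>. g \<omega> * indicator A (X \<omega>) \<partial>M) = c * measure std_normal_distribution A"
proof -
  let ?D = "density M (\<lambda>\<omega>. g \<omega> / c)"
  have int_g: "integrable M g"
    by (intro integrable_const_bound[where B = K] AE_I2) (simp_all add: g)
  have "complex_of_real (expectation g) = of_real c"
    using char[of 0] by simp
  then have Eg: "expectation g = c" by (simp only: of_real_eq_iff)
  have "emeasure ?D (space M) = (\<integral>\<^sup>+\<omega>. ennreal (g \<omega> / c) \<partial>M)"
    by (subst emeasure_density) (auto intro!: nn_integral_cong)
  also have "\<dots> = ennreal (\<integral>\<omega>. g \<omega> / c \<partial>M)"
    using int_g g \<open>0 < c\<close> by (intro nn_integral_eq_integral) auto
  also have "\<dots> = 1" using Eg \<open>0 < c\<close> by simp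
  finally interpret D: prob_space ?D
    by (intro prob_spaceI) simp
  have "real_distribution (distr ?D borel X)"
    by (intro real_distribution.intro real_distribution_axioms.intro D.prob_space_distr) auto
  moreover have "char (distr ?D borel X) = char std_normal_distribution"
  proof
    fix s
    have "char (distr ?D borel X) s = (CLINT \<omega>|?D. iexp (s * X \<omega>))"
      unfolding char_def by (subst integral_distr) auto
    also have "\<dots> = (CLINT \<omega>|M. (g \<omega> / c) *\<^sub>R iexp (s * X \<omega>))"
      using g \<open>0 < c\<close> by (subst integral_density) auto
    also have "\<dots> = (CLINT \<omega>|M. (of_real (g \<omega>) * iexp (s * X \<omega>)) / of_real c)"
      by (simp add: scaleR_conv_of_real)
    also have "\<dots> = of_real (exp (- s\<^sup>2 / 2))"
      using char[of s] \<open>0 < c\<close> by simp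
    finally show "char (distr ?D borel X) s = char std_normal_distribution s"
      by (simp add: char_std_normal_distribution)
  qed
  ultimately have law: "distr ?D borel X = std_normal_distribution"
    using real_dist_normal_dist by (intro Levy_uniqueness)
  have "measure std_normal_distribution A = measure ?D (X -` A \<inter> space M)"
    unfolding law[symmetric] by (subst measure_distr) auto
  also have "\<dots> = (\<integral>\<omega>. indicator (X -` A \<inter> space M) \<omega> \<partial>?D)"
    by simp
  also have "\<dots> = (\<integral>\<omega>. (g \<omega> / c) *\<^sub>R indicator (X -` A \<inter> space M) \<omega> \<partial>M)"
    using g \<open>0 < c\<close> by (subst integral_density) auto
  also have "\<dots> = (\<integral>\<omega>. (g \<omega> * indicator A (X \<omega>)) / c \<partial>M)"
    by (intro Bochner_Integration.integral_cong) (auto split: split_indicator)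
  finally show ?thesis using \<open>0 < c\<close> by simp
qed

text \<open>Independence from the joint characteristic function. Tilting by \<open>1 + cos (t * W)\<close> and by
\<open>1 + sin (t * W)\<close>, both nonnegative, leaves the law of \<open>X\<close> standard normal, so the restriction of the measure
to \<open>X \<in> A\<close> has a multiple of the normal characteristic function in \<open>W\<close>; tilting by the
indicator of this event then gives the joint law.\<close>

lemma std_normal_pair:
  fixes X W :: "'a \<Rightarrow> real"
  assumes [measurable]: "X \<in> borel_measurable M" "W \<in> borel_measurable M"
    and char: "\<And>a b. (CLINT \<omega>|M. iexp (a * X \<omega> + b * W \<omega>)) = of_real (exp (- (a\<^sup>2 + b\<^sup>2) / 2))"
    and [measurable]: "A \<in> sets borel" "B \<in> sets borel"
  shows "prob {\<omega>\<in>space M. X \<omega> \<in> A \<and> W \<omega> \<in> B}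
    = measure std_normal_distribution A * measure std_normal_distribution B"
proof -
  let ?\<nu> = "measure std_normal_distribution"
  have int: "integrable M (\<lambda>\<omega>. iexp (a * X \<omega> + b * W \<omega>))" for a b
    by (rule integrable_iexp) auto
  have E: "exp (- (s\<^sup>2 + t\<^sup>2) / 2) = exp (- t\<^sup>2 / 2) * exp (- s\<^sup>2 / 2)" for s t :: real
    by (simp add: exp_add[symmetric] field_simps)
  \<comment> \<open>Re-expressing the tilted characters through the joint characteristic function at \<open>(s, t)\<close>, \<open>(s, - t)\<close> and \<open>(s, 0)\<close>.\<close>
  have lin: "(CLINT \<omega>|M. f \<omega> + (g \<omega> + h \<omega>) / c) = (CLINT \<omega>|M. f \<omega>) + ((CLINT \<omega>|M. g \<omega>) + (CLINT \<omega>|M. h \<omega>)) / c"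
    "(CLINT \<omega>|M. f \<omega> + (g \<omega> - h \<omega>) / c) = (CLINT \<omega>|M. f \<omega>) + ((CLINT \<omega>|M. g \<omega>) - (CLINT \<omega>|M. h \<omega>)) / c"
    if "integrable M f" "integrable M g" "integrable M h" for f g h :: "'a \<Rightarrow> complex" and c
    using that by simp_all
  have cosE: "of_real (1 + cos (t * W \<omega>)) * iexp (s * X \<omega>) = iexp (s * X \<omega> + 0 * W \<omega>) +
      (iexp (s * X \<omega> + t * W \<omega>) + iexp (s * X \<omega> + (- t) * W \<omega>)) / 2" for s t \<omega>
    by (simp add: complex_eq_iff Re_exp Im_exp cos_add sin_add cos_diff sin_diff algebra_simps)
  have sinE: "of_real (1 + sin (t * W \<omega>)) * iexp (s * X \<omega>) = iexp (s * X \<omega> + 0 * W \<omega>) +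
      (iexp (s * X \<omega> + t * W \<omega>) - iexp (s * X \<omega> + (- t) * W \<omega>)) / (2 * \<i>)" for s t \<omega>
    by (simp add: complex_eq_iff Re_exp Im_exp cos_add sin_add cos_diff sin_diff algebra_simps Re_divide Im_divide power2_eq_square)
  have C: "(\<integral>\<omega>. (1 + cos (t * W \<omega>)) * indicator A (X \<omega>) \<partial>M) = (1 + exp (- t\<^sup>2 / 2)) * ?\<nu> A" for t
  proof (rule tilted_std_normal[where K = 2])
    fix s
    have "(CLINT \<omega>|M. of_real (1 + cos (t * W \<omega>)) * iexp (s * X \<omega>)) =
       (CLINT \<omega>|M. iexp (s * X \<omega> + 0 * W \<omega>)) +
       ((CLINT \<omega>|M. iexp (s * X \<omega> + t * W \<omega>)) + (CLINT \<omega>|M. iexp (s * X \<omega> + (- t) * W \<omega>))) / 2"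
      unfolding cosE by (intro lin int)
    also have "\<dots> = of_real ((1 + exp (- t\<^sup>2 / 2)) * exp (- s\<^sup>2 / 2))"
      unfolding char E by (simp add: algebra_simps)
    finally show "(CLINT \<omega>|M. of_real (1 + cos (t * W \<omega>)) * iexp (s * X \<omega>)) =
      of_real ((1 + exp (- t\<^sup>2 / 2)) * exp (- s\<^sup>2 / 2))" .
  next
    show "0 \<le> 1 + cos (t * W \<omega>)" for \<omega> using cos_ge_minus_one[of "t * W \<omega>"] by linarith
    show "1 + cos (t * W \<omega>) \<le> 2" for \<omega> using cos_le_one[of "t * W \<omega>"] by linarith
    show "0 < 1 + exp (- t\<^sup>2 / 2)" by (simp add: add_pos_pos)
  qed measurable
  have S: "(\<integral>\<omega>. (1 + sin (t * W \<omega>)) * indicator A (X \<omega>) \<partial>M) = 1 * ?\<nu> A" for t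
  proof (rule tilted_std_normal[where K = 2])
    fix s
    have "(CLINT \<omega>|M. of_real (1 + sin (t * W \<omega>)) * iexp (s * X \<omega>)) =
       (CLINT \<omega>|M. iexp (s * X \<omega> + 0 * W \<omega>)) +
       ((CLINT \<omega>|M. iexp (s * X \<omega> + t * W \<omega>)) - (CLINT \<omega>|M. iexp (s * X \<omega> + (- t) * W \<omega>))) / (2 * \<i>)"
      unfolding sinE by (intro lin int)
    also have "\<dots> = of_real (1 * exp (- s\<^sup>2 / 2))"
      unfolding char E by simp
    finally show "(CLINT \<omega>|M. of_real (1 + sin (t * W \<omega>)) * iexp (s * X \<omega>)) =
      of_real (1 * exp (- s\<^sup>2 / 2))" .
  next
    show "0 \<le> 1 + sin (t * W \<omega>)" for \<omega> using sin_ge_minus_one[of "t * W \<omega>"] by linarith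
    show "1 + sin (t * W \<omega>) \<le> 2" for \<omega> using sin_le_one[of "t * W \<omega>"] by linarith
  qed (auto intro: add_pos_pos)
  have PA: "(\<integral>\<omega>. indicator A (X \<omega>) \<partial>M) = ?\<nu> A"
    using S[of 0] by simp
  have intA: "integrable M (\<lambda>\<omega>. f \<omega> * indicator A (X \<omega>) :: real)"
    if "f \<in> borel_measurable M" "\<And>\<omega>. \<bar>f \<omega>\<bar> \<le> 1" for f
    using that by (intro integrable_const_bound[where B = 1]) (auto split: split_indicator)
  have cosA: "(\<integral>\<omega>. cos (t * W \<omega>) * indicator A (X \<omega>) \<partial>M) = exp (- t\<^sup>2 / 2) * ?\<nu> A" for t
  proof -
    have "(\<integral>\<omega>. (1 + cos (t * W \<omega>)) * indicator A (X \<omega>) \<partial>M) =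
      (\<integral>\<omega>. 1 * indicator A (X \<omega>) \<partial>M) + (\<integral>\<omega>. cos (t * W \<omega>) * indicator A (X \<omega>) \<partial>M)"
      unfolding distrib_right by (intro Bochner_Integration.integral_add intA) auto
    then show ?thesis using C[of t] PA by (simp add: algebra_simps)
  qed
  have sinA: "(\<integral>\<omega>. sin (t * W \<omega>) * indicator A (X \<omega>) \<partial>M) = 0" for t
  proof -
    have "(\<integral>\<omega>. (1 + sin (t * W \<omega>)) * indicator A (X \<omega>) \<partial>M) =
      (\<integral>\<omega>. 1 * indicator A (X \<omega>) \<partial>M) + (\<integral>\<omega>. sin (t * W \<omega>) * indicator A (X \<omega>) \<partial>M)"
      unfolding distrib_right by (intro Bochner_Integration.integral_add intA) auto
    then show ?thesis using S[of t] PA by (simp add: algebra_simps)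
  qed
  have prob_eq: "prob {\<omega>\<in>space M. X \<omega> \<in> A \<and> W \<omega> \<in> B}
      = (\<integral>\<omega>. indicator A (X \<omega>) * indicator B (W \<omega>) \<partial>M)"
  proof -
    have "prob {\<omega>\<in>space M. X \<omega> \<in> A \<and> W \<omega> \<in> B}
       = expectation (indicator {\<omega>\<in>space M. X \<omega> \<in> A \<and> W \<omega> \<in> B})"
      by (simp add: Int_absorb1 subset_eq)
    also have "\<dots> = (\<integral>\<omega>. indicator A (X \<omega>) * indicator B (W \<omega>) \<partial>M)"
      by (intro Bochner_Integration.integral_cong) (auto split: split_indicator)
    finally show ?thesis .
  qed
  show ?thesis
  proof (cases "?\<nu> A = 0")
    case True
    have "(\<integral>\<omega>. indicator A (X \<omega>) * indicator B (W \<omega>) \<partial>M) \<le> (\<integral>\<omega>. indicator A (X \<omega>) \<partial>M :: real)"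
      by (intro integral_mono integrable_const_bound[where B = 1]) (auto split: split_indicator)
    moreover have "0 \<le> (\<integral>\<omega>. indicator A (X \<omega>) * indicator B (W \<omega>) \<partial>M :: real)"
      by (intro Bochner_Integration.integral_nonneg) auto
    ultimately show ?thesis using True PA prob_eq by simp
  next
    case False
    then have "0 < ?\<nu> A" by (simp add: zero_less_measure_iff)
    show ?thesis unfolding prob_eq
    proof (rule tilted_std_normal[where K = 1])
      fix t
      have "(CLINT \<omega>|M. of_real (indicator A (X \<omega>)) * iexp (t * W \<omega>)) =
        (CLINT \<omega>|M. of_real (cos (t * W \<omega>) * indicator A (X \<omega>)) +
           \<i> * of_real (sin (t * W \<omega>) * indicator A (X \<omega>)))"
        by (intro Bochner_Integration.integral_cong) (auto simp: complex_eq_iff Re_exp Im_exp)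
      also have "\<dots> = of_real (\<integral>\<omega>. cos (t * W \<omega>) * indicator A (X \<omega>) \<partial>M) +
           \<i> * of_real (\<integral>\<omega>. sin (t * W \<omega>) * indicator A (X \<omega>) \<partial>M)"
      proof -
        have add: "(CLINT \<omega>|M. of_real (f \<omega>) + \<i> * of_real (h \<omega>)) = of_real (\<integral>\<omega>. f \<omega> \<partial>M) + \<i> * of_real (\<integral>\<omega>. h \<omega> \<partial>M)"
          if "integrable M f" "integrable M h" for f h :: "'a \<Rightarrow> real"
          using that by simp
        show ?thesis by (rule add; rule intA) auto
      qed
      also have "\<dots> = of_real (?\<nu> A * exp (- t\<^sup>2 / 2))"
        by (simp add: cosA sinA)
      finally show "(CLINT \<omega>|M. of_real (indicator A (X \<omega>)) * iexp (t * W \<omega>)) =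
        of_real (?\<nu> A * exp (- t\<^sup>2 / 2))" .
    qed (use \<open>0 < ?\<nu> A\<close> in \<open>auto split: split_indicator\<close>)
  qed
qed

text \<open>Decompose \<open>Y = \<rho> * X + s * W\<close> with \<open>W\<close> standard normal and independent of \<open>X\<close>. As long as
\<open>X\<close> stays below \<open>3 * L\<close>, the event \<open>v \<le> Y\<close> forces \<open>W\<close> above a level slightly lower
than \<open>v\<close>.\<close>

lemma bivariate_tail_far:
  fixes X Y :: "'a \<Rightarrow> real"
  assumes [measurable]: "X \<in> borel_measurable M" "Y \<in> borel_measurable M"
    and char: "\<And>a b. (CLINT \<omega>|M. iexp (a * X \<omega> + b * Y \<omega>))
                 = of_real (exp (- (a\<^sup>2 + b\<^sup>2 + 2 * a * b * \<rho>) / 2))"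
    and "\<bar>\<rho>\<bar> < 1" "0 \<le> u" "0 \<le> L" "3 * \<bar>\<rho>\<bar> * L \<le> v"
  shows "prob {\<omega>\<in>space M. u \<le> X \<omega> \<and> v \<le> Y \<omega>}
    \<le> normal_tail u * normal_tail (v - 3 * \<bar>\<rho>\<bar> * L) + normal_tail (3 * L)"
proof -
  define s where "s = sqrt (1 - \<rho>\<^sup>2)"
  have "\<rho>\<^sup>2 < 1" using \<open>\<bar>\<rho>\<bar> < 1\<close> by (simp add: abs_square_less_1)
  then have s: "0 < s" "s \<le> 1" "s\<^sup>2 = 1 - \<rho>\<^sup>2" by (auto simp: s_def)
  define W where "W = (\<lambda>\<omega>. (Y \<omega> - \<rho> * X \<omega>) / s)"
  have [measurable]: "W \<in> borel_measurable M" by (simp add: W_def)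
  have charW: "(CLINT \<omega>|M. iexp (a * X \<omega> + b * W \<omega>)) = of_real (exp (- (a\<^sup>2 + b\<^sup>2) / 2))" for a b
  proof -
    have "a * X \<omega> + b * W \<omega> = (a - b * \<rho> / s) * X \<omega> + (b / s) * Y \<omega>" for \<omega>
      by (simp add: W_def algebra_simps diff_divide_distrib)
    moreover have "(a - b * \<rho> / s)\<^sup>2 + (b / s)\<^sup>2 + 2 * (a - b * \<rho> / s) * (b / s) * \<rho> = a\<^sup>2 + b\<^sup>2"
    proof -
      have "(a - b * \<rho> / s)\<^sup>2 + (b / s)\<^sup>2 + 2 * (a - b * \<rho> / s) * (b / s) * \<rho> = a\<^sup>2 + b\<^sup>2 * ((1 - \<rho>\<^sup>2) / s\<^sup>2)"
        using s(1) by (simp add: power2_eq_square field_simps)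
      also have "(1 - \<rho>\<^sup>2) / s\<^sup>2 = 1" using s by (metis divide_self less_irrefl power_not_zero)
      finally show ?thesis by simp
    qed
    ultimately show ?thesis by (simp only: char)
  qed
  note pair = std_normal_pair[OF assms(1) \<open>W \<in> borel_measurable M\<close> charW]
  have 1: "prob {\<omega>\<in>space M. u \<le> X \<omega> \<and> v - 3 * \<bar>\<rho>\<bar> * L \<le> W \<omega>} = normal_tail u * normal_tail (v - 3 * \<bar>\<rho>\<bar> * L)"
    using pair[of "{u..}" "{v - 3 * \<bar>\<rho>\<bar> * L..}"] by (simp add: normal_tail_def)
  have 2: "prob {\<omega>\<in>space M. 3 * L \<le> X \<omega>} = normal_tail (3 * L)"
  proof -
    have "measure std_normal_distribution UNIV = 1"
      using std_normal.prob_space by simp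
    then show ?thesis using pair[of "{3 * L..}" UNIV] by (simp add: normal_tail_def)
  qed
  have "prob {\<omega>\<in>space M. u \<le> X \<omega> \<and> v \<le> Y \<omega>}
    \<le> prob ({\<omega>\<in>space M. u \<le> X \<omega> \<and> v - 3 * \<bar>\<rho>\<bar> * L \<le> W \<omega>} \<union> {\<omega>\<in>space M. 3 * L \<le> X \<omega>})"
  proof (intro finite_measure_mono subsetI)
    fix \<omega> assume \<omega>: "\<omega> \<in> {\<omega>\<in>space M. u \<le> X \<omega> \<and> v \<le> Y \<omega>}"
    show "\<omega> \<in> {\<omega>\<in>space M. u \<le> X \<omega> \<and> v - 3 * \<bar>\<rho>\<bar> * L \<le> W \<omega>} \<union> {\<omega>\<in>space M. 3 * L \<le> X \<omega>}"
    proof (cases "3 * L \<le> X \<omega>")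
      case False
      have "\<rho> * X \<omega> \<le> \<bar>\<rho>\<bar> * (3 * L)"
        using False \<omega> \<open>0 \<le> u\<close> by (intro mult_mono) auto
      then have le: "v - 3 * \<bar>\<rho>\<bar> * L \<le> Y \<omega> - \<rho> * X \<omega>" using \<omega> by simp
      with assms have "0 \<le> Y \<omega> - \<rho> * X \<omega>" by linarith
      then have "(Y \<omega> - \<rho> * X \<omega>) * s \<le> (Y \<omega> - \<rho> * X \<omega>) * 1"
        using s by (intro mult_left_mono) auto
      then have "Y \<omega> - \<rho> * X \<omega> \<le> W \<omega>" using s by (simp add: W_def field_simps)
      with le \<omega> show ?thesis by auto
    qed (use \<omega> in auto)
  qed measurable
  also have "\<dots> \<le> prob {\<omega>\<in>space M. u \<le> X \<omega> \<and> v - 3 * \<bar>\<rho>\<bar> * L \<le> W \<omega>} + prob {\<omega>\<in>space M. 3 * L \<le> X \<omega>}"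
    by (intro measure_Un_le) measurable
  finally show ?thesis by (simp add: 1 2)
qed

end

section \<open>The stationary Gaussian process and its copies\<close>

lemma sample_path_measurable:
  "(\<And>t. 0 \<le> t \<Longrightarrow> X t \<in> borel_measurable M) \<Longrightarrow> sample_path X \<in> measurable M path_space"
  unfolding sample_path_def by (rule measurable_restrict) auto

locale stationary_gaussian = prob_space N for N :: "'b measure" +
  fixes X :: "real \<Rightarrow> 'b \<Rightarrow> real"
  assumes gaussian: "gaussian_process N X"
    and stationary: "stationary_process N X"
    and mean: "\<And>t. 0 \<le> t \<Longrightarrow> expectation (X t) = 0"
    and second_moment: "\<And>t. 0 \<le> t \<Longrightarrow> expectation (\<lambda>\<omega>. (X t \<omega>)\<^sup>2) = 1"
begin

abbreviation \<rho> :: "real \<Rightarrow> real" where "\<rho> \<equiv> corr_fun N X"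

lemma X_measurable [measurable]: "0 \<le> t \<Longrightarrow> X t \<in> borel_measurable N"
  using gaussian by (simp add: gaussian_process_def)

lemma X_square_integrable: "0 \<le> t \<Longrightarrow> integrable N (\<lambda>\<omega>. (X t \<omega>)\<^sup>2)"
  using second_moment[of t] not_integrable_integral_eq by fastforce

lemma X_mult_integrable:
  assumes "0 \<le> s" "0 \<le> t"
  shows "integrable N (\<lambda>\<omega>. X s \<omega> * X t \<omega>)"
proof (rule Bochner_Integration.integrable_bound)
  show "integrable N (\<lambda>\<omega>. (X s \<omega>)\<^sup>2 + (X t \<omega>)\<^sup>2)"
    using assms by (intro Bochner_Integration.integrable_add X_square_integrable)
  show "AE \<omega> in N. norm (X s \<omega> * X t \<omega>) \<le> norm ((X s \<omega>)\<^sup>2 + (X t \<omega>)\<^sup>2)"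
  proof (rule AE_I2)
    fix \<omega>
    have "2 * \<bar>X s \<omega> * X t \<omega>\<bar> \<le> (X s \<omega>)\<^sup>2 + (X t \<omega>)\<^sup>2"
      using sum_squares_bound[of "\<bar>X s \<omega>\<bar>" "\<bar>X t \<omega>\<bar>"] by (simp add: abs_mult)
    then show "norm (X s \<omega> * X t \<omega>) \<le> norm ((X s \<omega>)\<^sup>2 + (X t \<omega>)\<^sup>2)"
      by simp
  qed
qed (use assms in measurable)

lemma X_integrable: "0 \<le> t \<Longrightarrow> integrable N (X t)"
  by (rule square_integrable_imp_integrable) (auto intro: X_square_integrable)

text \<open>Stationarity is a statement about laws on the product space of paths; evaluating a path at two times
is measurable there, which turns it into a statement about covariances.\<close>

lemma covariance:
  assumes "0 \<le> s" "0 \<le> t"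
  shows "expectation (\<lambda>\<omega>. X s \<omega> * X t \<omega>) = \<rho> \<bar>t - s\<bar>"
proof -
  have main: "expectation (\<lambda>\<omega>. X (h + s) \<omega> * X s \<omega>) = \<rho> h" if "0 \<le> s" "0 \<le> h" for s h
  proof -
    have eval: "(\<lambda>p. p h * p 0) \<in> borel_measurable path_space"
      using that by (intro borel_measurable_times measurable_component_singleton) auto
    have meas: "sample_path (\<lambda>t. X (t + s)) \<in> measurable N path_space"
      "sample_path X \<in> measurable N path_space"
      using that by (auto intro!: sample_path_measurable)
    have "expectation (\<lambda>\<omega>. X (h + s) \<omega> * X s \<omega>)
       = expectation (\<lambda>\<omega>. sample_path (\<lambda>t. X (t + s)) \<omega> h * sample_path (\<lambda>t. X (t + s)) \<omega> 0)"
      using that by (simp add: sample_path_def)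
    also have "\<dots> = (\<integral>p. p h * p 0 \<partial>process_law N (\<lambda>t. X (t + s)))"
      unfolding process_law_def by (rule integral_distr[OF meas(1) eval, symmetric])
    also have "\<dots> = (\<integral>p. p h * p 0 \<partial>process_law N X)"
      using stationary that by (simp add: stationary_process_def)
    also have "\<dots> = expectation (\<lambda>\<omega>. sample_path X \<omega> h * sample_path X \<omega> 0)"
      unfolding process_law_def by (rule integral_distr[OF meas(2) eval])
    also have "\<dots> = \<rho> h"
      using that by (simp add: sample_path_def corr_fun_def)
    finally show ?thesis .
  qed
  show ?thesis
    using main[of s "t - s"] main[of t "s - t"] assms
    by (cases "s \<le> t") (auto simp: mult.commute)
qed

lemma correlation_le_1:
  assumes "0 \<le> t"
  shows "\<bar>\<rho> t\<bar> \<le> 1"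
proof -
  have "2 * \<bar>\<rho> t\<bar> = \<bar>expectation (\<lambda>\<omega>. 2 * (X 0 \<omega> * X t \<omega>))\<bar>"
    using covariance[of 0 t] assms by simp
  also have "\<dots> \<le> expectation (\<lambda>\<omega>. \<bar>2 * (X 0 \<omega> * X t \<omega>)\<bar>)"
    by (rule integral_abs_bound)
  also have "\<dots> \<le> expectation (\<lambda>\<omega>. (X 0 \<omega>)\<^sup>2 + (X t \<omega>)\<^sup>2)"
  proof (intro integral_mono integrable_abs integrable_mult_right
      Bochner_Integration.integrable_add X_mult_integrable X_square_integrable)
    fix \<omega>
    show "\<bar>2 * (X 0 \<omega> * X t \<omega>)\<bar> \<le> (X 0 \<omega>)\<^sup>2 + (X t \<omega>)\<^sup>2"
      using sum_squares_bound[of "\<bar>X 0 \<omega>\<bar>" "\<bar>X t \<omega>\<bar>"] by (simp add: abs_mult)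
  qed (use assms in auto)
  also have "\<dots> = 2"
    using assms by (subst Bochner_Integration.integral_add) (auto intro: X_square_integrable simp: second_moment)
  finally show ?thesis by simp
qed

lemma pair_moments:
  assumes "0 \<le> s" "0 \<le> t"
  shows "expectation (\<lambda>\<omega>. a * X s \<omega> + b * X t \<omega>) = 0"
    and "expectation (\<lambda>\<omega>. (a * X s \<omega> + b * X t \<omega>)\<^sup>2) = a\<^sup>2 + b\<^sup>2 + 2 * a * b * \<rho> \<bar>t - s\<bar>"
proof -
  show "expectation (\<lambda>\<omega>. a * X s \<omega> + b * X t \<omega>) = 0"
    using assms by (simp add: X_integrable mean)
  have "(a * X s \<omega> + b * X t \<omega>)\<^sup>2 = a\<^sup>2 * (X s \<omega>)\<^sup>2 + b\<^sup>2 * (X t \<omega>)\<^sup>2 + 2 * a * b * (X s \<omega> * X t \<omega>)" for \<omega>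
    by (simp add: power2_eq_square algebra_simps)
  then show "expectation (\<lambda>\<omega>. (a * X s \<omega> + b * X t \<omega>)\<^sup>2) = a\<^sup>2 + b\<^sup>2 + 2 * a * b * \<rho> \<bar>t - s\<bar>"
    using assms by (simp add: X_square_integrable X_mult_integrable second_moment covariance)
qed

lemma pair_gaussian:
  assumes "0 \<le> s" "0 \<le> t" "s \<noteq> t"
  shows "gaussian_rv N (\<lambda>\<omega>. a * X s \<omega> + b * X t \<omega>)"
proof -
  have *: "\<And>T c. finite T \<Longrightarrow> T \<subseteq> {0..} \<Longrightarrow> gaussian_rv N (\<lambda>\<omega>. \<Sum>t\<in>T. c t * X t \<omega>)"
    using gaussian by (simp add: gaussian_process_def)
  show ?thesis
    using *[of "{s, t}" "\<lambda>x. if x = s then a else b"] assms by auto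
qed

lemma pair_variance_pos:
  assumes "0 \<le> s" "0 \<le> t" "\<bar>\<rho> \<bar>t - s\<bar>\<bar> < 1" "a \<noteq> 0 \<or> b \<noteq> 0"
  shows "0 < a\<^sup>2 + b\<^sup>2 + 2 * a * b * \<rho> \<bar>t - s\<bar>"
proof -
  let ?r = "\<rho> \<bar>t - s\<bar>"
  have "\<bar>2 * a * b * ?r\<bar> = (2 * \<bar>a\<bar> * \<bar>b\<bar>) * \<bar>?r\<bar>" by (simp add: abs_mult)
  also have "\<dots> \<le> (a\<^sup>2 + b\<^sup>2) * \<bar>?r\<bar>"
    using sum_squares_bound[of "\<bar>a\<bar>" "\<bar>b\<bar>"] by (intro mult_right_mono) auto
  also have "\<dots> < (a\<^sup>2 + b\<^sup>2) * 1"
    using assms by (intro mult_strict_left_mono) (auto simp: sum_power2_gt_zero_iff)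
  finally show ?thesis by (simp add: abs_less_iff)
qed

lemma pair_char:
  assumes "0 \<le> s" "0 \<le> t" "s \<noteq> t" "\<bar>\<rho> \<bar>t - s\<bar>\<bar> < 1"
  shows "(CLINT \<omega>|N. iexp (a * X s \<omega> + b * X t \<omega>))
    = of_real (exp (- (a\<^sup>2 + b\<^sup>2 + 2 * a * b * \<rho> \<bar>t - s\<bar>) / 2))"
proof (cases "a = 0 \<and> b = 0")
  case True
  then show ?thesis by (simp add: prob_space)
next
  case False
  then show ?thesis
    using assms by (intro gaussian_rv_char pair_gaussian pair_moments pair_variance_pos) auto
qed

lemma tail:
  assumes "0 \<le> t"
  shows "prob {\<omega>\<in>space N. u \<le> X t \<omega>} = normal_tail u"
proof -
  have "gaussian_rv N (X t)"
    using pair_gaussian[of t "t + 1" 1 0] assms by simp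
  then show ?thesis
    using gaussian_rv_tail[of "X t" 1 u] assms mean second_moment by simp
qed

text \<open>If both variables are at least \<open>u\<close>, then their sum is at least \<open>2 * u\<close>, that is, a standard
normal variable is at least \<open>u * sqrt (2 / (1 + \<rho>))\<close>.\<close>

lemma pair_tail_near:
  assumes "0 \<le> s" "0 \<le> t" "s \<noteq> t" "\<bar>\<rho> \<bar>t - s\<bar>\<bar> < 1" "1 \<le> u"
  shows "prob {\<omega>\<in>space N. u \<le> X s \<omega> \<and> u \<le> X t \<omega>}
    \<le> exp (3 / 2) * normal_tail u * exp (- (u\<^sup>2 * (1 - \<rho> \<bar>t - s\<bar>) / 4))"
proof -
  define r where "r = \<rho> \<bar>t - s\<bar>"
  have r: "- 1 < r" "r < 1" using assms by (auto simp: r_def abs_less_iff)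
  define w where "w = 2 * u / sqrt (2 + 2 * r)"
  have w2: "w\<^sup>2 = u\<^sup>2 * (2 / (1 + r))"
    using r by (simp add: w_def power_divide power_mult_distrib field_simps)
  have "1 + (1 - r) / 2 \<le> 2 / (1 + r)"
    using r zero_le_power2[of "1 - r"] by (simp add: field_simps power2_eq_square)
  then have gain: "u\<^sup>2 + u\<^sup>2 * (1 - r) / 2 \<le> w\<^sup>2"
    unfolding w2 using mult_left_mono[of "1 + (1 - r) / 2" "2 / (1 + r)" "u\<^sup>2"]
    by (simp add: algebra_simps)
  moreover have "0 \<le> u\<^sup>2 * (1 - r) / 2" using r by simp
  ultimately have "u\<^sup>2 \<le> w\<^sup>2" by linarith
  moreover have "0 \<le> w" using assms r by (simp add: w_def)
  ultimately have "u \<le> w" by (rule power2_le_imp_le)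
  have "prob {\<omega>\<in>space N. u \<le> X s \<omega> \<and> u \<le> X t \<omega>}
    \<le> prob {\<omega>\<in>space N. 2 * u \<le> 1 * X s \<omega> + 1 * X t \<omega>}"
    using assms by (intro finite_measure_mono) auto
  also have "\<dots> = normal_tail (2 * u / sqrt (1\<^sup>2 + 1\<^sup>2 + 2 * 1 * 1 * \<rho> \<bar>t - s\<bar>))"
    using assms by (intro gaussian_rv_tail pair_gaussian pair_moments pair_variance_pos) auto
  also have "\<dots> = normal_tail w" by (simp add: w_def r_def)
  also have "\<dots> \<le> exp (3 / 2) * normal_tail u * exp (- (u\<^sup>2 * (1 - r) / 2) / 2)"
    using assms \<open>u \<le> w\<close> gain by (intro normal_tail_gain)
  finally show ?thesis by (simp add: r_def)
qed

lemma pair_tail_far: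
  assumes "0 \<le> s" "0 \<le> t" "s \<noteq> t" "\<bar>\<rho> \<bar>t - s\<bar>\<bar> < 1"
    and "0 \<le> u" "0 \<le> L" "3 * \<bar>\<rho> \<bar>t - s\<bar>\<bar> * L \<le> v"
  shows "prob {\<omega>\<in>space N. u \<le> X s \<omega> \<and> v \<le> X t \<omega>}
    \<le> normal_tail u * normal_tail (v - 3 * \<bar>\<rho> \<bar>t - s\<bar>\<bar> * L) + normal_tail (3 * L)"
  using assms by (intro bivariate_tail_far pair_char) auto

end

lemma independent_copies_prob:
  assumes "prob_space M" "independent_copies M J Xs N X" "finite K" "K \<subseteq> J" "K \<noteq> {}"
    and X: "\<And>t. 0 \<le> t \<Longrightarrow> X t \<in> borel_measurable N"
    and A: "A \<in> sets path_space"
  shows "measure M {\<omega>\<in>space M. \<forall>j\<in>K. sample_path (Xs j) \<omega> \<in> A}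
    = measure N {\<omega>\<in>space N. sample_path X \<omega> \<in> A} ^ card K"
proof -
  interpret prob_space M by fact
  have ind: "indep_vars (\<lambda>_. path_space) (\<lambda>j. sample_path (Xs j)) J"
    and law: "\<And>j. j \<in> J \<Longrightarrow> process_law M (Xs j) = process_law N X"
    and meas: "\<And>j t. j \<in> J \<Longrightarrow> 0 \<le> t \<Longrightarrow> Xs j t \<in> borel_measurable M"
    using assms(2) by (auto simp: independent_copies_def)
  have one: "prob {\<omega>\<in>space M. sample_path (Xs j) \<omega> \<in> A} = measure N {\<omega>\<in>space N. sample_path X \<omega> \<in> A}"
    if "j \<in> J" for j
  proof -
    have "measure (process_law M (Xs j)) A = measure (process_law N X) A"
      using law[OF that] by simp
    then show ?thesis
      unfolding process_law_def using A that meas X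
      by (simp add: measure_distr sample_path_measurable vimage_def Int_def conj_commute)
  qed
  have "indep_events (\<lambda>j. {\<omega>\<in>space M. sample_path (Xs j) \<omega> \<in> A}) J"
    using A sets.sets_into_space[OF A]
    by (intro indep_eventsI_indep_vars[OF ind, where P = "\<lambda>_ p. p \<in> A"])
       (auto simp: Collect_conj_eq Int_absorb1)
  then have "prob (\<Inter>j\<in>K. {\<omega>\<in>space M. sample_path (Xs j) \<omega> \<in> A})
      = (\<Prod>j\<in>K. prob {\<omega>\<in>space M. sample_path (Xs j) \<omega> \<in> A})"
    using assms unfolding indep_events_def by blast
  also have "\<dots> = measure N {\<omega>\<in>space N. sample_path X \<omega> \<in> A} ^ card K"
    using assms(4) by (subst prod.cong[OF refl one]) auto
  also have "(\<Inter>j\<in>K. {\<omega>\<in>space M. sample_path (Xs j) \<omega> \<in> A})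
     = {\<omega>\<in>space M. \<forall>j\<in>K. sample_path (Xs j) \<omega> \<in> A}"
    using \<open>K \<noteq> {}\<close> by auto
  finally show ?thesis .
qed

lemma independent_copies_pair:
  assumes "prob_space M" "independent_copies M J Xs N X" "finite K" "K \<subseteq> J" "K \<noteq> {}"
    and X: "\<And>t. 0 \<le> t \<Longrightarrow> X t \<in> borel_measurable N"
    and "0 \<le> s" "0 \<le> t"
  shows "measure M {\<omega>\<in>space M. \<forall>j\<in>K. u \<le> Xs j s \<omega> \<and> v \<le> Xs j t \<omega>}
    = measure N {\<omega>\<in>space N. u \<le> X s \<omega> \<and> v \<le> X t \<omega>} ^ card K"
proof -
  let ?A = "{p\<in>space path_space. u \<le> p s \<and> v \<le> p t}"
  have A: "?A \<in> sets path_space"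
  proof -
    have [measurable]: "(\<lambda>p. p s) \<in> borel_measurable path_space" "(\<lambda>p. p t) \<in> borel_measurable path_space"
      using assms by (auto intro!: measurable_component_singleton)
    show ?thesis by measurable
  qed
  show ?thesis
    using independent_copies_prob[OF assms(1-5) X A]
    unfolding sample_path_def using assms(7,8) by (simp add: space_PiM)
qed

section \<open>A second moment criterion\<close>

context prob_space begin

text \<open>With \<open>S\<close> the sum of \<open>Z k\<close> over a long stretch of indices and \<open>\<mu>\<close> its mean, the variance of
\<open>S\<close> is at most \<open>C * \<mu> + \<epsilon> * \<mu>\<^sup>2\<close>, so the probability that \<open>S\<close> vanishes is at most
\<open>C / \<mu> + \<epsilon>\<close>. Here \<open>\<mu>\<close> can be made arbitrarily large and \<open>\<epsilon>\<close> arbitrarily small.\<close>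
lemma infinitely_often_by_second_moment:
  fixes Z :: "nat \<Rightarrow> 'a \<Rightarrow> real"
  assumes [measurable]: "\<And>k. Z k \<in> borel_measurable M"
    and nonneg: "\<And>k \<omega>. 0 \<le> Z k \<omega>"
    and int: "\<And>k. integrable M (Z k)"
    and int2: "\<And>k j. integrable M (\<lambda>\<omega>. Z k \<omega> * Z j \<omega>)"
    and diag: "\<forall>\<^sub>F k in sequentially. expectation (\<lambda>\<omega>. Z k \<omega> * Z k \<omega>) \<le> C * expectation (Z k)"
    and off_diag: "\<And>\<epsilon>. 0 < \<epsilon> \<Longrightarrow> \<exists>k0. \<forall>k\<ge>k0. \<forall>j>k.
          expectation (\<lambda>\<omega>. Z k \<omega> * Z j \<omega>) \<le> (1 + \<epsilon>) * (expectation (Z k) * expectation (Z j))"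
    and div: "\<not> summable (\<lambda>k. expectation (Z k))"
  shows "AE \<omega> in M. \<exists>\<^sub>F k in sequentially. Z k \<omega> \<noteq> 0"
proof -
  let ?e = "\<lambda>k. expectation (Z k)"
  have e_nonneg: "0 \<le> ?e k" for k
    by (intro Bochner_Integration.integral_nonneg nonneg)
  have small: "prob {\<omega>\<in>space M. \<forall>k\<ge>k1. Z k \<omega> = 0} \<le> 2 * \<epsilon>" if "0 < \<epsilon>" for k1 \<epsilon>
  proof -
    from diag obtain k2 where k2: "\<And>k. k2 \<le> k \<Longrightarrow> expectation (\<lambda>\<omega>. Z k \<omega> * Z k \<omega>) \<le> C * ?e k"
      by (auto simp: eventually_sequentially)
    from off_diag[OF that] obtain k3 where k3: "\<And>k j. k3 \<le> k \<Longrightarrow> k < j \<Longrightarrow>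
        expectation (\<lambda>\<omega>. Z k \<omega> * Z j \<omega>) \<le> (1 + \<epsilon>) * (?e k * ?e j)" by blast
    define k0 where "k0 = max k1 (max k2 k3)"
    have pair: "expectation (\<lambda>\<omega>. Z k \<omega> * Z j \<omega>)
        \<le> (if j = k then C * ?e k else 0) + (1 + \<epsilon>) * (?e k * ?e j)"
      if "k0 \<le> k" "k0 \<le> j" for k j
    proof (cases j k rule: linorder_cases)
      case equal
      have "0 \<le> (1 + \<epsilon>) * (?e k * ?e k)" using \<open>0 < \<epsilon>\<close> e_nonneg by simp
      then show ?thesis using equal k2[of k] that by (simp add: k0_def)
    next
      case less
      then show ?thesis using k3[of j k] that by (simp add: k0_def mult.commute)
    next
      case greater
      then show ?thesis using k3[of k j] that by (simp add: k0_def)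
    qed
    define \<mu> where "\<mu> = (\<lambda>K. \<Sum>k\<in>{k0..<K}. ?e k)"
    have "filterlim \<mu> at_top sequentially"
    proof -
      have nsum: "\<not> summable (\<lambda>i. ?e (i + k0))" using div summable_iff_shift[of ?e k0] by blast
      then have "\<exists>n. B \<le> \<mu> n" for B
      proof -
        have "\<exists>n. B < (\<Sum>i<n. ?e (i + k0))"
        proof (rule ccontr)
          assume none: "\<not> (\<exists>n. B < (\<Sum>i<n. ?e (i + k0)))"
          have "(\<Sum>i\<le>n. ?e (i + k0)) \<le> B" for n
            using none[unfolded not_ex not_less] unfolding lessThan_Suc_atMost[symmetric] by blast
          then have "summable (\<lambda>i. ?e (i + k0))"
            by (rule bounded_imp_summable[OF e_nonneg])
          with nsum show False by contradiction
        qed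
        then obtain n where "B < (\<Sum>i<n. ?e (i + k0))" by blast
        also have "\<dots> = \<mu> (n + k0)"
          unfolding \<mu>_def using sum.shift_bounds_nat_ivl[of ?e 0 k0 n] by (simp add: atLeast0LessThan)
        finally show ?thesis by (intro exI[of _ "n + k0"]) simp
      qed
      moreover have "incseq \<mu>"
        unfolding \<mu>_def by (intro monoI sum_mono2 e_nonneg) auto
      ultimately show ?thesis
        unfolding filterlim_at_top eventually_sequentially
        by (metis incseqD order_trans)
    qed
    then have "\<forall>\<^sub>F K in sequentially. max 1 (C / \<epsilon>) \<le> \<mu> K"
      unfolding filterlim_at_top by blast
    then obtain K where "max 1 (C / \<epsilon>) \<le> \<mu> K"
      unfolding eventually_sequentially by blast
    then have \<mu>: "1 \<le> \<mu> K" "C \<le> \<epsilon> * \<mu> K"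
      using \<open>0 < \<epsilon>\<close> by (simp_all add: pos_divide_le_eq mult.commute)
    define S where "S = (\<lambda>\<omega>. \<Sum>k\<in>{k0..<K}. Z k \<omega>)"
    have [measurable]: "S \<in> borel_measurable M" by (simp add: S_def)
    have ES: "expectation S = \<mu> K"
      unfolding S_def \<mu>_def by (intro Bochner_Integration.integral_sum int)
    have S2: "(S \<omega>)\<^sup>2 = (\<Sum>k\<in>{k0..<K}. \<Sum>j\<in>{k0..<K}. Z k \<omega> * Z j \<omega>)" for \<omega>
      by (simp add: S_def power2_eq_square sum_product)
    have intS: "integrable M S" unfolding S_def by (intro Bochner_Integration.integrable_sum int)
    have intS2: "integrable M (\<lambda>\<omega>. (S \<omega>)\<^sup>2)"
      unfolding S2 by (intro Bochner_Integration.integrable_sum int2)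
    have "expectation (\<lambda>\<omega>. (S \<omega>)\<^sup>2)
      = (\<Sum>k\<in>{k0..<K}. \<Sum>j\<in>{k0..<K}. expectation (\<lambda>\<omega>. Z k \<omega> * Z j \<omega>))"
      unfolding S2 by (simp add: Bochner_Integration.integral_sum int2)
    also have "\<dots> \<le> (\<Sum>k\<in>{k0..<K}. \<Sum>j\<in>{k0..<K}.
        (if j = k then C * ?e k else 0) + (1 + \<epsilon>) * (?e k * ?e j))"
      by (intro sum_mono pair) auto
    also have "\<dots> = C * \<mu> K + (1 + \<epsilon>) * (\<mu> K)\<^sup>2"
    proof -
      have sq: "(\<mu> K)\<^sup>2 = (\<Sum>k\<in>{k0..<K}. \<Sum>j\<in>{k0..<K}. ?e k * ?e j)"
        by (simp add: \<mu>_def power2_eq_square sum_product)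
      show ?thesis unfolding sq by (simp add: \<mu>_def sum.distrib sum_distrib_left)
    qed
    finally have ES2: "expectation (\<lambda>\<omega>. (S \<omega>)\<^sup>2) \<le> C * \<mu> K + (1 + \<epsilon>) * (\<mu> K)\<^sup>2" .
    have "variance S \<le> C * \<mu> K + \<epsilon> * (\<mu> K)\<^sup>2"
      using ES2 by (subst variance_eq[OF intS intS2]) (simp add: ES algebra_simps)
    also have "\<dots> \<le> (\<epsilon> * \<mu> K) * \<mu> K + \<epsilon> * (\<mu> K)\<^sup>2"
      using \<mu> by (intro add_right_mono mult_right_mono) auto
    finally have var: "variance S \<le> 2 * \<epsilon> * (\<mu> K)\<^sup>2"
      by (simp add: power2_eq_square)
    have "prob {\<omega>\<in>space M. \<forall>k\<ge>k1. Z k \<omega> = 0}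
      \<le> prob {\<omega>\<in>space M. \<mu> K \<le> \<bar>S \<omega> - expectation S\<bar>}"
    proof (intro finite_measure_mono subsetI)
      fix \<omega> assume \<omega>: "\<omega> \<in> {\<omega>\<in>space M. \<forall>k\<ge>k1. Z k \<omega> = 0}"
      then have "S \<omega> = 0" unfolding S_def by (intro sum.neutral) (auto simp: k0_def)
      with \<omega> \<mu> show "\<omega> \<in> {\<omega>\<in>space M. \<mu> K \<le> \<bar>S \<omega> - expectation S\<bar>}" by (simp add: ES)
    qed measurable
    also have "\<dots> \<le> variance S / (\<mu> K)\<^sup>2"
      using \<mu> intS2 by (intro Chebyshev_inequality) auto
    also have "\<dots> \<le> 2 * \<epsilon>"
      using var \<mu> by (simp add: divide_le_eq)
    finally show ?thesis .
  qed
  have "AE \<omega> in M. \<not> (\<forall>k\<ge>k1. Z k \<omega> = 0)" for k1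
  proof -
    let ?B = "{\<omega>\<in>space M. \<forall>k\<ge>k1. Z k \<omega> = 0}"
    have "prob ?B \<le> 0"
    proof (rule field_le_epsilon)
      fix e :: real assume "0 < e"
      then show "prob ?B \<le> 0 + e" using small[of "e / 2" k1] by simp
    qed
    then have "emeasure M ?B = 0"
      using measure_nonneg[of M ?B] by (simp add: emeasure_eq_measure)
    then show ?thesis
      by (intro AE_I[where N = ?B]) (blast, assumption, measurable)
  qed
  then have "AE \<omega> in M. \<forall>k1. \<not> (\<forall>k\<ge>k1. Z k \<omega> = 0)"
    unfolding AE_all_countable by blast
  then show ?thesis
    by eventually_elim (simp only: frequently_sequentially, blast)
qed

end

section \<open>Blocks of grid points and their levels\<close>

text \<open>The level function for \<open>p = 0\<close> at time \<open>exp k\<close>.\<close>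

definition block_level :: "real \<Rightarrow> nat \<Rightarrow> nat \<Rightarrow> real" where
  "block_level \<alpha> m k = sqrt (2 / real m * (real k + ((2 - real m * \<alpha>) / (2 * \<alpha>) + 1) * ln (real k)))"

definition mesh :: "real \<Rightarrow> nat \<Rightarrow> real" where
  "mesh \<alpha> k = real k powr (- 1 / \<alpha>)"

definition block_size :: "real \<Rightarrow> nat \<Rightarrow> nat" where
  "block_size \<alpha> k = nat \<lfloor>exp (real k) * real k powr (1 / \<alpha>) / 4\<rfloor>"

definition block_time :: "real \<Rightarrow> nat \<Rightarrow> nat \<Rightarrow> real" where
  "block_time \<alpha> k l = 3 / 4 * exp (real k) + real l * mesh \<alpha> k"

lemma summable_exp_powr:
  assumes "0 < c" "0 < a"
  shows "summable (\<lambda>d :: nat. exp (- (c * real d powr a)))"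
proof (rule summable_comparison_test_ev)
  have "\<forall>\<^sub>F d :: nat in sequentially. exp (- (c * real d powr a)) \<le> 1 / real d ^ 2"
    using assms by real_asymp
  then show "\<forall>\<^sub>F d :: nat in sequentially. norm (exp (- (c * real d powr a))) \<le> 1 / real d ^ 2"
    by simp
  show "summable (\<lambda>d :: nat. 1 / real d ^ 2)"
    using inverse_power_summable[of 2, where 'a = real] by (simp add: inverse_eq_divide)
qed

lemma eventually_powr_exp_le_1:
  "0 < b \<Longrightarrow> \<forall>\<^sub>F k :: nat in sequentially. real k powr e * exp (- (b * real k)) \<le> 1"
  by real_asymp

lemma tendsto_mult_exp_0:
  "0 < b \<Longrightarrow> (\<lambda>k :: nat. real k * exp (- (b * real k))) \<longlonglongrightarrow> 0"
  by real_asymp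

lemma eventually_log_small:
  "\<forall>\<^sub>F k :: nat in sequentially. \<bar>b * ln (real k)\<bar> \<le> real k / 2"
proof -
  have "(\<lambda>k :: nat. ln (real k) / real k) \<longlonglongrightarrow> 0" by real_asymp
  then have "(\<lambda>k :: nat. \<bar>b * (ln (real k) / real k)\<bar>) \<longlonglongrightarrow> \<bar>b * 0\<bar>" by (intro tendsto_intros)
  then have "\<forall>\<^sub>F k :: nat in sequentially. \<bar>b * (ln (real k) / real k)\<bar> < 1 / 2"
    by (intro order_tendstoD) auto
  with eventually_gt_at_top[of 0] show ?thesis
    by eventually_elim (simp add: abs_mult field_simps)
qed

lemma block_level_square:
  assumes "1 \<le> m"
  shows "\<forall>\<^sub>F k in sequentially.
    (block_level \<alpha> m k)\<^sup>2 = 2 / real m * (real k + ((2 - real m * \<alpha>) / (2 * \<alpha>) + 1) * ln (real k)) \<and>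
    real k / real m \<le> (block_level \<alpha> m k)\<^sup>2 \<and> (block_level \<alpha> m k)\<^sup>2 \<le> 3 * real k / real m"
  using eventually_log_small[of "(2 - real m * \<alpha>) / (2 * \<alpha>) + 1"]
proof eventually_elim
  case (elim k)
  define y where "y = ((2 - real m * \<alpha>) / (2 * \<alpha>) + 1) * ln (real k)"
  have y: "\<bar>y\<bar> \<le> real k / 2" using elim by (simp add: y_def)
  then have "0 \<le> real k + y" by linarith
  then have sq: "(block_level \<alpha> m k)\<^sup>2 = 2 / real m * (real k + y)"
    using assms by (simp add: block_level_def y_def)
  have "1 / real m * real k \<le> 1 / real m * (2 * (real k + y))"
    "1 / real m * (2 * (real k + y)) \<le> 1 / real m * (3 * real k)"
    using assms y by (intro mult_left_mono; simp; linarith)+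
  then show ?case using sq by (simp add: y_def)
qed

lemma block_level_ge_1:
  assumes "1 \<le> m"
  shows "\<forall>\<^sub>F k in sequentially. 1 \<le> block_level \<alpha> m k"
  using block_level_square[OF assms, of \<alpha>] eventually_ge_at_top[of m]
proof eventually_elim
  case (elim k)
  then have "1 \<le> real k / real m" using assms by simp
  with elim have sq: "1\<^sup>2 \<le> (block_level \<alpha> m k)\<^sup>2" by simp
  have "0 \<le> block_level \<alpha> m k"
  proof (rule ccontr)
    assume neg: "\<not> 0 \<le> block_level \<alpha> m k"
    then have "2 / real m * (real k + ((2 - real m * \<alpha>) / (2 * \<alpha>) + 1) * ln (real k)) < 0"
      unfolding block_level_def by (simp only: real_sqrt_ge_0_iff not_le)
    with elim have "(block_level \<alpha> m k)\<^sup>2 < 0" by simp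
    then show False by simp
  qed
  with sq show ?case by (rule power2_le_imp_le)
qed

text \<open>The exponent of \<open>log s\<close> in the level is chosen so that the powers of \<open>k\<close> from the
level and from the denominator of the normal tail combine to \<open>- 1 / \<alpha> - 1\<close>.\<close>

lemma block_level_tail_power:
  assumes "1 \<le> m" "0 < \<alpha>"
  obtains c1 c2 where "0 < c1" "0 < c2"
    "\<forall>\<^sub>F k in sequentially.
       c1 * (exp (- real k) * real k powr (- 1 / \<alpha> - 1)) \<le> normal_tail (block_level \<alpha> m k) ^ m \<and>
       normal_tail (block_level \<alpha> m k) ^ m \<le> c2 * (exp (- real k) * real k powr (- 1 / \<alpha> - 1))"
proof -
  let ?c = "(1 / sqrt (2 * pi)) ^ m"
  define b where "b = (2 - real m * \<alpha>) / (2 * \<alpha>) + 1"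
  have b: "- b - real m / 2 = - 1 / \<alpha> - 1"
    using assms by (simp add: b_def field_simps)
  define c1 where "c1 = exp (- 3 / 2) ^ m * ?c * (3 / real m) powr (- real m / 2)"
  define c2 where "c2 = ?c * (1 / real m) powr (- real m / 2)"
  have pos: "0 < c1" "0 < c2" using assms by (auto simp: c1_def c2_def)
  show ?thesis
  proof (rule that[OF pos])
    show "\<forall>\<^sub>F k in sequentially.
       c1 * (exp (- real k) * real k powr (- 1 / \<alpha> - 1)) \<le> normal_tail (block_level \<alpha> m k) ^ m \<and>
       normal_tail (block_level \<alpha> m k) ^ m \<le> c2 * (exp (- real k) * real k powr (- 1 / \<alpha> - 1))"
      using block_level_square[OF assms(1), of \<alpha>] block_level_ge_1[OF assms(1), of \<alpha>] eventually_ge_at_top[of 1]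
    proof eventually_elim
      case (elim k)
      define v where "v = block_level \<alpha> m k"
      have v: "1 \<le> v" "v\<^sup>2 = 2 / real m * (real k + b * ln (real k))"
        "real k / real m \<le> v\<^sup>2" "v\<^sup>2 \<le> 3 * real k / real m"
        using elim by (auto simp: v_def b_def)
      have k: "1 \<le> real k" using elim by simp
      have dens: "std_normal_density v ^ m = ?c * (exp (- real k) * real k powr (- b))"
      proof -
        have "std_normal_density v ^ m = ?c * exp (real m * (- v\<^sup>2 / 2))"
          unfolding std_normal_density_def power_mult_distrib exp_of_nat_mult ..
        also have "real m * (- v\<^sup>2 / 2) = - real k + - b * ln (real k)"
          unfolding v(2) using assms by (simp add: field_simps)
        also have "exp (- real k + - b * ln (real k)) = exp (- real k) * real k powr (- b)"
          using k unfolding exp_add by (simp add: powr_def)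
        finally show ?thesis .
      qed
      have vm: "(1 / v) ^ m = (v\<^sup>2) powr (- real m / 2)"
      proof -
        have "(v\<^sup>2) powr (- real m / 2) = v powr (- real m)"
          using v(1) by (simp add: powr_powr powr_numeral[symmetric] del: powr_numeral)
        also have "\<dots> = (1 / v) ^ m"
          using v(1) by (simp add: powr_minus powr_realpow power_one_over inverse_eq_divide)
        finally show ?thesis by simp
      qed
      have "(3 * real k / real m) powr (- real m / 2) \<le> (v\<^sup>2) powr (- real m / 2)"
        using v(1,3,4) k assms by (intro powr_mono2') auto
      moreover have "(3 * real k / real m) powr (- real m / 2)
          = (3 / real m) powr (- real m / 2) * real k powr (- real m / 2)"
        using k by (simp add: powr_mult[symmetric])
      ultimately have lo: "(3 / real m) powr (- real m / 2) * real k powr (- real m / 2) \<le> (1 / v) ^ m"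
        by (simp add: vm)
      have "(v\<^sup>2) powr (- real m / 2) \<le> (real k / real m) powr (- real m / 2)"
        using v(1,3,4) k assms by (intro powr_mono2') auto
      moreover have "(real k / real m) powr (- real m / 2)
          = (1 / real m) powr (- real m / 2) * real k powr (- real m / 2)"
        using k by (simp add: powr_mult[symmetric])
      ultimately have hi: "(1 / v) ^ m \<le> (1 / real m) powr (- real m / 2) * real k powr (- real m / 2)"
        by (simp add: vm)
      have comb: "real k powr (- b) * real k powr (- real m / 2) = real k powr (- 1 / \<alpha> - 1)"
        using b by (simp add: powr_add[symmetric])
      have D: "0 \<le> std_normal_density v ^ m" by simp
      have "normal_tail v ^ m \<le> (std_normal_density v / v) ^ m"
        using v by (intro power_mono normal_tail_upper normal_tail_nonneg) auto
      also have "\<dots> = std_normal_density v ^ m * (1 / v) ^ m"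
        by (simp add: power_divide)
      also have "\<dots> \<le> std_normal_density v ^ m * ((1 / real m) powr (- real m / 2) * real k powr (- real m / 2))"
        by (intro mult_left_mono hi D)
      also have "\<dots> = c2 * (exp (- real k) * (real k powr (- b) * real k powr (- real m / 2)))"
        unfolding dens c2_def by (simp only: mult_ac)
      finally have upper: "normal_tail v ^ m \<le> c2 * (exp (- real k) * real k powr (- 1 / \<alpha> - 1))"
        by (simp only: comb)
      have "c1 * (exp (- real k) * (real k powr (- b) * real k powr (- real m / 2))) =
         exp (- 3 / 2) ^ m * (std_normal_density v ^ m * ((3 / real m) powr (- real m / 2) * real k powr (- real m / 2)))"
        unfolding dens c1_def by (simp only: mult_ac)
      also have "\<dots> \<le> exp (- 3 / 2) ^ m * (std_normal_density v ^ m * (1 / v) ^ m)"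
        by (intro mult_left_mono lo D) auto
      also have "\<dots> = (exp (- 3 / 2) * (std_normal_density v / v)) ^ m"
        by (simp add: power_divide power_mult_distrib)
      also have "\<dots> \<le> normal_tail v ^ m"
        using v by (intro power_mono normal_tail_lower) auto
      finally have lower: "c1 * (exp (- real k) * real k powr (- 1 / \<alpha> - 1)) \<le> normal_tail v ^ m"
        by (simp only: comb)
      show ?case using lower upper by (simp add: v_def)
    qed
  qed
qed

lemma block_size_bounds:
  assumes "0 < \<alpha>"
  shows "real (block_size \<alpha> k) \<le> exp (real k) * real k powr (1 / \<alpha>) / 4"
    and "\<forall>\<^sub>F k in sequentially. exp (real k) * real k powr (1 / \<alpha>) / 8 \<le> real (block_size \<alpha> k)"
proof -
  show "real (block_size \<alpha> k) \<le> exp (real k) * real k powr (1 / \<alpha>) / 4"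
    unfolding block_size_def by (intro of_nat_floor) simp
  have "\<forall>\<^sub>F k in sequentially. 8 \<le> exp (real k)" by real_asymp
  then show "\<forall>\<^sub>F k in sequentially. exp (real k) * real k powr (1 / \<alpha>) / 8 \<le> real (block_size \<alpha> k)"
    using eventually_ge_at_top[of 1]
  proof eventually_elim
    case (elim k)
    define x where "x = exp (real k) * real k powr (1 / \<alpha>)"
    have "8 * 1 \<le> x"
      unfolding x_def using elim assms by (intro mult_mono) (auto intro: ge_one_powr_ge_zero)
    then show ?case unfolding block_size_def x_def[symmetric] by linarith
  qed
qed

text \<open>The factor \<open>k powr (1 / \<alpha>)\<close> from the grid reduces the tail probability to the
harmonic series.\<close>

lemma block_expectation_bounds:
  assumes "1 \<le> m" "0 < \<alpha>"
  shows "\<not> summable (\<lambda>k. real (block_size \<alpha> k) * normal_tail (block_level \<alpha> m k) ^ m)"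
    and "\<exists>c. \<forall>\<^sub>F k in sequentially. real (block_size \<alpha> k) * normal_tail (block_level \<alpha> m k) ^ m \<le> c"
proof -
  obtain c1 c2 where c: "0 < c1" "0 < c2" and tail: "\<forall>\<^sub>F k in sequentially.
       c1 * (exp (- real k) * real k powr (- 1 / \<alpha> - 1)) \<le> normal_tail (block_level \<alpha> m k) ^ m \<and>
       normal_tail (block_level \<alpha> m k) ^ m \<le> c2 * (exp (- real k) * real k powr (- 1 / \<alpha> - 1))"
    using block_level_tail_power[OF assms] .
  have prod: "exp (real k) * real k powr (1 / \<alpha>) * (exp (- real k) * real k powr (- 1 / \<alpha> - 1)) = 1 / real k"
    if "1 \<le> k" for k :: nat
  proof -
    have "exp (real k) * real k powr (1 / \<alpha>) * (exp (- real k) * real k powr (- 1 / \<alpha> - 1))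
       = (exp (real k) * exp (- real k)) * (real k powr (1 / \<alpha>) * real k powr (- 1 / \<alpha> - 1))"
      by (simp only: mult_ac)
    also have "\<dots> = real k powr (1 / \<alpha> + (- 1 / \<alpha> - 1))"
      by (simp add: exp_minus_inverse powr_add[symmetric])
    also have "\<dots> = 1 / real k"
      using that by (simp add: powr_minus_divide)
    finally show ?thesis .
  qed
  have lower: "\<forall>\<^sub>F k in sequentially. c1 / 8 * (1 / real k)
      \<le> real (block_size \<alpha> k) * normal_tail (block_level \<alpha> m k) ^ m"
    using tail block_size_bounds(2)[OF assms(2)] eventually_ge_at_top[of 1]
  proof eventually_elim
    case (elim k)
    have "c1 / 8 * (1 / real k) = (exp (real k) * real k powr (1 / \<alpha>) / 8)
        * (c1 * (exp (- real k) * real k powr (- 1 / \<alpha> - 1)))"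
      using prod[of k] elim by (simp add: field_simps)
    also have "\<dots> \<le> real (block_size \<alpha> k) * normal_tail (block_level \<alpha> m k) ^ m"
      using elim c by (intro mult_mono) auto
    finally show ?case .
  qed
  show "\<not> summable (\<lambda>k. real (block_size \<alpha> k) * normal_tail (block_level \<alpha> m k) ^ m)"
  proof
    assume "summable (\<lambda>k. real (block_size \<alpha> k) * normal_tail (block_level \<alpha> m k) ^ m)"
    moreover have "\<forall>\<^sub>F k in sequentially. norm (c1 / 8 * (1 / real k))
       \<le> real (block_size \<alpha> k) * normal_tail (block_level \<alpha> m k) ^ m"
      using lower by eventually_elim (use c in simp)
    ultimately have "summable (\<lambda>k. c1 / 8 * (1 / real k))"
      by (rule summable_comparison_test_ev[rotated])
    then have "summable (\<lambda>k. 1 / real k)"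
      using c by (subst (asm) summable_cmult_iff) auto
    then show False
      using not_summable_harmonic[where 'a = real] by (simp add: inverse_eq_divide)
  qed
  have "\<forall>\<^sub>F k in sequentially. real (block_size \<alpha> k) * normal_tail (block_level \<alpha> m k) ^ m \<le> c2"
    using tail eventually_ge_at_top[of 1]
  proof eventually_elim
    case (elim k)
    have "real (block_size \<alpha> k) * normal_tail (block_level \<alpha> m k) ^ m
      \<le> (exp (real k) * real k powr (1 / \<alpha>) / 4) * (c2 * (exp (- real k) * real k powr (- 1 / \<alpha> - 1)))"
      using elim block_size_bounds(1)[OF assms(2)] normal_tail_nonneg by (intro mult_mono) auto
    also have "\<dots> = c2 / 4 * (1 / real k)"
      using prod[of k] elim by (simp add: field_simps)
    also have "\<dots> \<le> c2 * 1"
      using elim c by (intro mult_mono) auto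
    finally show ?case by simp
  qed
  then show "\<exists>c. \<forall>\<^sub>F k in sequentially. real (block_size \<alpha> k) * normal_tail (block_level \<alpha> m k) ^ m \<le> c"
    by blast
qed

section \<open>Joint exceedances at two grid points\<close>

text \<open>The hypotheses on the correlation with explicit constants: it leaves 1 at least as fast as
\<open>1 - c * h powr \<alpha>\<close> on \<open>(0, h0)\<close>, stays away from 1 beyond \<open>h0\<close> and decays polynomially beyond \<open>T0\<close>.\<close>

locale correlation_decay = stationary_gaussian N X for N :: "'b measure" and X +
  fixes \<alpha> c h0 \<kappa> D T0 lam :: real
  assumes \<alpha>_pos: "0 < \<alpha>" and c_pos: "0 < c" and h0_pos: "0 < h0" and \<kappa>_pos: "0 < \<kappa>"
    and D_pos: "0 < D" and lam_pos: "0 < lam"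
    and corr_lt_1: "\<And>h. 0 < h \<Longrightarrow> \<bar>\<rho> h\<bar> < 1"
    and corr_near: "\<And>h. 0 < h \<Longrightarrow> h < h0 \<Longrightarrow> c * h powr \<alpha> \<le> 1 - \<rho> h"
    and corr_mid: "\<And>h. h0 \<le> h \<Longrightarrow> \<kappa> \<le> 1 - \<rho> h"
    and corr_far: "\<And>h. T0 \<le> h \<Longrightarrow> \<bar>\<rho> h\<bar> \<le> D * h powr (- 2 * lam)"
begin

text \<open>At distances exponential in \<open>k\<close> the correlation is exponentially small in \<open>k\<close>, while the
squared level of block \<open>k\<close> is at most \<open>3 * k / m\<close>.\<close>

lemma corr_far_small:
  assumes "0 < \<eta>" "0 < a" "0 < g"
  shows "\<forall>\<^sub>F k :: nat in sequentially. \<forall>h\<ge>g * exp (a * real k). \<bar>\<rho> h\<bar> * (3 * real k / real m) \<le> \<eta>"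
proof -
  define b where "b = 2 * lam * a"
  have "0 < b" using assms lam_pos by (simp add: b_def)
  have "(g * exp (a * x)) powr (- 2 * lam) = g powr (- 2 * lam) * exp (- (b * x))" for x
    using assms by (simp add: powr_mult exp_powr_real b_def)
  then have eq: "D * (g * exp (a * real k)) powr (- 2 * lam) * (3 * real k / real m)
      = D * g powr (- 2 * lam) * 3 / real m * (real k * exp (- (b * real k)))" for k
    by simp
  have "(\<lambda>k :: nat. real k * exp (- (b * real k))) \<longlonglongrightarrow> 0"
    using \<open>0 < b\<close> by (rule tendsto_mult_exp_0)
  then have "(\<lambda>k :: nat. D * (g * exp (a * real k)) powr (- 2 * lam) * (3 * real k / real m)) \<longlonglongrightarrow> 0"
    unfolding eq by (rule tendsto_mult_right_zero)
  then have "\<forall>\<^sub>F k :: nat in sequentially. D * (g * exp (a * real k)) powr (- 2 * lam) * (3 * real k / real m) < \<eta>"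
    using assms by (intro order_tendstoD)
  moreover have "\<forall>\<^sub>F k :: nat in sequentially. T0 \<le> g * exp (a * real k)"
  proof -
    have "filterlim (\<lambda>k :: nat. g * exp (a * real k)) at_top sequentially"
      using assms by real_asymp
    then show ?thesis unfolding filterlim_at_top by blast
  qed
  ultimately show ?thesis
  proof eventually_elim
    case (elim k)
    show ?case
    proof (intro allI impI)
      fix h assume h: "g * exp (a * real k) \<le> h"
      have "\<bar>\<rho> h\<bar> \<le> D * h powr (- 2 * lam)"
        using elim h by (intro corr_far) auto
      also have "\<dots> \<le> D * (g * exp (a * real k)) powr (- 2 * lam)"
        using D_pos lam_pos h assms by (intro mult_left_mono powr_mono2') auto
      finally have "\<bar>\<rho> h\<bar> * (3 * real k / real m)
        \<le> D * (g * exp (a * real k)) powr (- 2 * lam) * (3 * real k / real m)"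
        by (intro mult_right_mono) auto
      with elim show "\<bar>\<rho> h\<bar> * (3 * real k / real m) \<le> \<eta>" by linarith
    qed
  qed
qed

lemma block_level_large:
  assumes "1 \<le> m"
  shows "\<forall>\<^sub>F k in sequentially. L \<le> block_level \<alpha> m k"
proof -
  have "filterlim (\<lambda>k. real k / real m) at_top sequentially"
    using assms by real_asymp
  then have "\<forall>\<^sub>F k in sequentially. L\<^sup>2 \<le> real k / real m"
    unfolding filterlim_at_top by blast
  then show ?thesis
    using block_level_square[OF assms, of \<alpha>] block_level_ge_1[OF assms, of \<alpha>]
  proof eventually_elim
    case (elim k)
    then have "L\<^sup>2 \<le> (block_level \<alpha> m k)\<^sup>2" by linarith
    then show ?case by (rule power2_le_imp_le) (use elim in linarith)
  qed
qed

text \<open>Bound, up to a constant, for the probability of an exceedance at a grid point given one at distance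
\<open>d\<close> grid steps in the same block. The summands come from short distances, where the correlation is
governed by its behaviour at 0; from intermediate ones, where it only stays away from 1; and from long
ones, where the two points are almost independent. The cut-off \<open>exp (\<kappa> / 8 * k)\<close> in time is so small that
the number of intermediate points does not outweigh \<open>exp (- \<kappa> / 4 * k)\<close>.\<close>

definition pair_weight :: "nat \<Rightarrow> nat \<Rightarrow> nat \<Rightarrow> real" where
  "pair_weight m k d =
     exp (- (c / 4 * real d powr \<alpha>)) +
     (if real d \<le> exp (\<kappa> / 8 * real k) * real k powr (1 / \<alpha>) then exp (- (\<kappa> / 4 * real k)) else 0) +
     normal_tail (block_level \<alpha> m k) ^ m"

lemma block_pair_bound:
  assumes m: "1 \<le> m"
  shows "\<forall>\<^sub>F k in sequentially. \<forall>d\<ge>1. \<forall>s\<ge>0. \<forall>t\<ge>0. \<bar>t - s\<bar> = real d * mesh \<alpha> k \<longrightarrow>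
     prob {\<omega>\<in>space N. block_level \<alpha> m k \<le> X s \<omega> \<and> block_level \<alpha> m k \<le> X t \<omega>} ^ m
     \<le> exp (3 / 2) ^ m * normal_tail (block_level \<alpha> m k) ^ m * pair_weight m k d"
proof -
  obtain L0 \<eta>0 where far: "1 \<le> L0" "0 < \<eta>0"
    "\<And>L u v r. L0 \<le> L \<Longrightarrow> 1 \<le> u \<Longrightarrow> u \<le> L \<Longrightarrow> 1 \<le> v \<Longrightarrow> v \<le> L \<Longrightarrow> \<bar>r\<bar> * L\<^sup>2 \<le> \<eta>0 \<Longrightarrow>
       3 * \<bar>r\<bar> * L \<le> v \<and>
       normal_tail u * normal_tail (v - 3 * \<bar>r\<bar> * L) + normal_tail (3 * L)
       \<le> (1 + 1) * (normal_tail u * normal_tail v)"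
    using far_tail_bound[of 1] by (metis zero_less_one)
  have "0 < \<kappa> / 8" using \<kappa>_pos by simp
  note farev = corr_far_small[OF \<open>0 < \<eta>0\<close> this zero_less_one, of m]
  show ?thesis
    using block_level_square[OF m, of \<alpha>] block_level_ge_1[OF m, of \<alpha>]
      block_level_large[OF m, of L0] farev eventually_ge_at_top[of 1]
  proof eventually_elim
    case (elim k)
    define v where "v = block_level \<alpha> m k"
    have v: "1 \<le> v" "L0 \<le> v" "real k / real m \<le> v\<^sup>2" "v\<^sup>2 \<le> 3 * real k / real m"
      using elim by (auto simp: v_def)
    have k: "1 \<le> real k" using elim by simp
    let ?p = "normal_tail v ^ m" and ?A = "exp (3 / 2 :: real) ^ m"
    have p0: "0 \<le> ?p" by (simp add: normal_tail_nonneg)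
    show ?case
    proof (intro allI impI)
      fix d :: nat and s t :: real
      assume d: "1 \<le> d" and st: "0 \<le> s" "0 \<le> t" and h: "\<bar>t - s\<bar> = real d * mesh \<alpha> k"
      define h where "h = real d * mesh \<alpha> k"
      have h_pos: "0 < h" using d k by (simp add: h_def mesh_def)
      have "s \<noteq> t" using h h_pos h_def by auto
      have r1: "\<bar>\<rho> \<bar>t - s\<bar>\<bar> < 1" using h h_pos h_def corr_lt_1 by simp
      let ?Q = "prob {\<omega>\<in>space N. v \<le> X s \<omega> \<and> v \<le> X t \<omega>}"
      have h_powr: "h powr \<alpha> = real d powr \<alpha> / real k"
        using d k \<alpha>_pos by (simp add: h_def mesh_def powr_mult powr_divide powr_powr powr_minus_divide)
      \<comment> \<open>The \<open>m\<close>th power turns the gain \<open>v\<^sup>2 * (1 - \<rho> h) / 4\<close> in the exponent into at least \<open>k * (1 - \<rho> h) / 4\<close>.\<close>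
      have near: "?Q ^ m \<le> ?A * ?p * exp (- e)" if "e \<le> real k * (1 - \<rho> h) / 4" for e
      proof -
        have "real k * (1 - \<rho> h) / 4 \<le> real m * (v\<^sup>2 * (1 - \<rho> h) / 4)"
        proof -
          have "0 \<le> 1 - \<rho> h" using corr_lt_1[OF h_pos] by (simp add: abs_less_iff)
          moreover have "real k \<le> real m * v\<^sup>2" using v(3) m by (simp add: field_simps)
          ultimately have "real k * (1 - \<rho> h) \<le> real m * v\<^sup>2 * (1 - \<rho> h)" by (rule mult_right_mono[rotated])
          then show ?thesis by simp
        qed
        with that have e: "e \<le> real m * (v\<^sup>2 * (1 - \<rho> h) / 4)" by linarith
        have "?Q ^ m \<le> (exp (3 / 2) * normal_tail v * exp (- (v\<^sup>2 * (1 - \<rho> h) / 4))) ^ m"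
          using pair_tail_near[OF st \<open>s \<noteq> t\<close> r1 v(1)] h h_def by (intro power_mono) auto
        also have "\<dots> = ?A * ?p * exp (- (real m * (v\<^sup>2 * (1 - \<rho> h) / 4)))"
          unfolding power_mult_distrib exp_of_nat_mult[symmetric] by simp
        also have "\<dots> \<le> ?A * ?p * exp (- e)"
          using e p0 by (intro mult_left_mono) auto
        finally show ?thesis .
      qed
      have weight: "?A * ?p * w \<le> ?A * ?p * pair_weight m k d" if "w \<le> pair_weight m k d" for w
        using that p0 by (intro mult_left_mono) auto
      have "?Q ^ m \<le> ?A * ?p * pair_weight m k d"
      proof (cases "real d \<le> exp (\<kappa> / 8 * real k) * real k powr (1 / \<alpha>)")
        case True
        show ?thesis
        proof (cases "h < h0")
          case small: True
          have "c / 4 * real d powr \<alpha> = real k * (c * h powr \<alpha>) / 4"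
            using k by (simp add: h_powr)
          also have "\<dots> \<le> real k * (1 - \<rho> h) / 4"
            using corr_near[OF h_pos small] k by (intro divide_right_mono mult_left_mono) auto
          finally have "?Q ^ m \<le> ?A * ?p * exp (- (c / 4 * real d powr \<alpha>))" by (rule near)
          also have "\<dots> \<le> ?A * ?p * pair_weight m k d"
            using p0 by (intro weight) (simp add: pair_weight_def v_def)
          finally show ?thesis .
        next
          case False
          have "\<kappa> / 4 * real k = real k * \<kappa> / 4" by simp
          also have "\<dots> \<le> real k * (1 - \<rho> h) / 4"
            using corr_mid[of h] False k by (intro divide_right_mono mult_left_mono) auto
          finally have "?Q ^ m \<le> ?A * ?p * exp (- (\<kappa> / 4 * real k))" by (rule near)
          also have "\<dots> \<le> ?A * ?p * pair_weight m k d"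
            using p0 True by (intro weight) (simp add: pair_weight_def v_def)
          finally show ?thesis .
        qed
      next
        case False
        have "exp (\<kappa> / 8 * real k) = exp (\<kappa> / 8 * real k) * real k powr (1 / \<alpha>) * mesh \<alpha> k"
          using k by (simp add: mesh_def powr_add[symmetric])
        also have "\<dots> \<le> h"
          unfolding h_def using False by (intro mult_right_mono) (auto simp: mesh_def)
        finally have "\<bar>\<rho> h\<bar> * (3 * real k / real m) \<le> \<eta>0" using elim by simp
        moreover have "\<bar>\<rho> h\<bar> * v\<^sup>2 \<le> \<bar>\<rho> h\<bar> * (3 * real k / real m)"
          using v by (intro mult_left_mono) auto
        ultimately have "\<bar>\<rho> h\<bar> * v\<^sup>2 \<le> \<eta>0" by linarith
        note f = far(3)[OF v(2,1) order_refl v(1) order_refl this]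
        have "?Q \<le> normal_tail v * normal_tail (v - 3 * \<bar>\<rho> h\<bar> * v) + normal_tail (3 * v)"
          using pair_tail_far[OF st \<open>s \<noteq> t\<close> r1, of v v v] f v h h_def by auto
        with f have "?Q \<le> 2 * (normal_tail v * normal_tail v)" by simp
        also have "\<dots> \<le> exp (3 / 2) * (normal_tail v * normal_tail v)"
          using exp_ge_add_one_self[of "3 / 2 :: real"]
          by (intro mult_right_mono) (auto simp: normal_tail_nonneg)
        finally have "?Q ^ m \<le> (exp (3 / 2) * (normal_tail v * normal_tail v)) ^ m"
          by (intro power_mono) auto
        also have "\<dots> = ?A * ?p * ?p" by (simp add: power_mult_distrib)
        also have "\<dots> \<le> ?A * ?p * pair_weight m k d"
          by (intro weight) (simp add: pair_weight_def v_def)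
        finally show ?thesis .
      qed
      then show "prob {\<omega>\<in>space N. block_level \<alpha> m k \<le> X s \<omega> \<and> block_level \<alpha> m k \<le> X t \<omega>} ^ m
         \<le> exp (3 / 2) ^ m * normal_tail (block_level \<alpha> m k) ^ m * pair_weight m k d"
        by (simp add: v_def)
    qed
  qed
qed

lemma pair_weight_sum:
  assumes m: "1 \<le> m"
  obtains S where "0 \<le> S" "\<forall>\<^sub>F k in sequentially. (\<Sum>d\<in>{1..<block_size \<alpha> k}. pair_weight m k d) \<le> S"
proof -
  have "summable (\<lambda>d :: nat. exp (- (c / 4 * real d powr \<alpha>)))"
    using c_pos \<alpha>_pos by (intro summable_exp_powr) auto
  then have near: "(\<Sum>d\<in>{1..<n}. exp (- (c / 4 * real d powr \<alpha>))) \<le> (\<Sum>d. exp (- (c / 4 * real d powr \<alpha>)))" for n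
    by (intro sum_le_suminf) auto
  have nonneg: "0 \<le> (\<Sum>d. exp (- (c / 4 * real d powr \<alpha>)))"
    using near[of 1] by simp
  obtain C where C: "\<forall>\<^sub>F k in sequentially. real (block_size \<alpha> k) * normal_tail (block_level \<alpha> m k) ^ m \<le> C"
    using block_expectation_bounds(2)[OF m \<alpha>_pos] by blast
  have mid: "\<forall>\<^sub>F k in sequentially.
      exp (\<kappa> / 8 * real k) * real k powr (1 / \<alpha>) * exp (- (\<kappa> / 4 * real k)) \<le> 1"
  proof -
    define b e where "b = \<kappa> / 8" and "e = 1 / \<alpha>"
    have "0 < b" using \<kappa>_pos by (simp add: b_def)
    then have "\<forall>\<^sub>F k :: nat in sequentially. real k powr e * exp (- (b * real k)) \<le> 1"
      by (rule eventually_powr_exp_le_1)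
    moreover have "exp (\<kappa> / 8 * real k) * real k powr (1 / \<alpha>) * exp (- (\<kappa> / 4 * real k))
        = real k powr e * exp (- (b * real k))" for k
    proof -
      have *: "\<kappa> / 8 * real k + - (\<kappa> / 4 * real k) = - (b * real k)" by (simp add: b_def)
      have "exp (\<kappa> / 8 * real k) * real k powr (1 / \<alpha>) * exp (- (\<kappa> / 4 * real k))
          = real k powr e * exp (\<kappa> / 8 * real k + - (\<kappa> / 4 * real k))"
        unfolding e_def exp_add by (simp only: mult_ac)
      with * show ?thesis by (simp only:)
    qed
    ultimately show ?thesis by simp
  qed
  show ?thesis
  proof (rule that)
    show "\<forall>\<^sub>F k in sequentially. (\<Sum>d\<in>{1..<block_size \<alpha> k}. pair_weight m k d)
       \<le> (\<Sum>d. exp (- (c / 4 * real d powr \<alpha>))) + 1 + \<bar>C\<bar>"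
      using C mid
    proof eventually_elim
      case (elim k)
      define Y where "Y = exp (\<kappa> / 8 * real k) * real k powr (1 / \<alpha>)"
      define n where "n = block_size \<alpha> k"
      have "(\<Sum>d\<in>{1..<n}. if real d \<le> Y then exp (- (\<kappa> / 4 * real k)) else 0)
         = (\<Sum>d\<in>{1..<n} \<inter> {d. real d \<le> Y}. exp (- (\<kappa> / 4 * real k)))"
        by (subst sum.inter_restrict) auto
      also have "\<dots> = real (card ({1..<n} \<inter> {d. real d \<le> Y})) * exp (- (\<kappa> / 4 * real k))"
        by simp
      also have "\<dots> \<le> Y * exp (- (\<kappa> / 4 * real k))"
      proof (intro mult_right_mono)
        have "0 \<le> Y" by (simp add: Y_def)
        have "card ({1..<n} \<inter> {d. real d \<le> Y}) \<le> card {1..nat \<lfloor>Y\<rfloor>}"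
          by (intro card_mono) (auto simp: le_nat_floor)
        then have "real (card ({1..<n} \<inter> {d. real d \<le> Y})) \<le> real (nat \<lfloor>Y\<rfloor>)" by simp
        also have "\<dots> \<le> Y" using \<open>0 \<le> Y\<close> by (rule of_nat_floor)
        finally show "real (card ({1..<n} \<inter> {d. real d \<le> Y})) \<le> Y" .
      qed simp
      also have "\<dots> \<le> 1" using elim by (simp add: Y_def)
      finally have 2: "(\<Sum>d\<in>{1..<n}. if real d \<le> Y then exp (- (\<kappa> / 4 * real k)) else 0) \<le> 1" .
      have "(\<Sum>d\<in>{1..<n}. normal_tail (block_level \<alpha> m k) ^ m)
        \<le> real n * normal_tail (block_level \<alpha> m k) ^ m"
        by (simp add: mult_right_mono normal_tail_nonneg)
      also have "\<dots> \<le> \<bar>C\<bar>" using elim by (simp add: n_def)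
      finally have 3: "(\<Sum>d\<in>{1..<n}. normal_tail (block_level \<alpha> m k) ^ m) \<le> \<bar>C\<bar>" .
      show ?case
        unfolding pair_weight_def sum.distrib Y_def[symmetric] n_def[symmetric]
        using near[of n] 2 3 by (intro add_mono)
    qed
  qed (use nonneg in simp)
qed

end

section \<open>Infinitely many blocks contain an exceedance\<close>

text \<open>The index of \<open>q\<close> is the distance of \<open>l\<close> and \<open>l'\<close>, written with truncated subtraction; every
positive distance occurs at most twice.\<close>

lemma sum_nat_distance_le:
  fixes q :: "nat \<Rightarrow> real"
  assumes "\<And>d. 0 \<le> q d" "l < n"
  shows "(\<Sum>l'\<in>{..<n} - {l}. q ((l' - l) + (l - l'))) \<le> 2 * (\<Sum>d\<in>{1..<n}. q d)"
proof -
  have eq: "{..<n} - {l} = {..<l} \<union> {l<..<n}" using assms by auto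
  have "(\<Sum>l'\<in>{..<n} - {l}. q ((l' - l) + (l - l')))
    = (\<Sum>l'\<in>{..<l}. q ((l' - l) + (l - l'))) + (\<Sum>l'\<in>{l<..<n}. q ((l' - l) + (l - l')))"
    unfolding eq by (intro sum.union_disjoint) auto
  also have "(\<Sum>l'\<in>{..<l}. q ((l' - l) + (l - l'))) = (\<Sum>d\<in>{1..l}. q d)"
    by (rule sum.reindex_bij_witness[where i = "\<lambda>d. l - d" and j = "\<lambda>l'. l - l'"]) auto
  also have "(\<Sum>l'\<in>{l<..<n}. q ((l' - l) + (l - l'))) = (\<Sum>d\<in>{1..<n - l}. q d)"
    by (rule sum.reindex_bij_witness[where i = "\<lambda>d. l + d" and j = "\<lambda>l'. l' - l"]) auto
  also have "(\<Sum>d\<in>{1..l}. q d) + (\<Sum>d\<in>{1..<n - l}. q d) \<le> (\<Sum>d\<in>{1..<n}. q d) + (\<Sum>d\<in>{1..<n}. q d)"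
    using assms by (intro add_mono sum_mono2) auto
  finally show ?thesis by simp
qed

lemma block_time_bounds:
  assumes "0 < \<alpha>" "1 \<le> k" "l < block_size \<alpha> k"
  shows "3 / 4 * exp (real k) \<le> block_time \<alpha> k l" "block_time \<alpha> k l \<le> exp (real k)"
proof -
  have "real l * mesh \<alpha> k \<le> exp (real k) * real k powr (1 / \<alpha>) / 4 * mesh \<alpha> k"
    using assms block_size_bounds(1)[OF assms(1), of k]
    by (intro mult_right_mono) (auto simp: mesh_def)
  also have "\<dots> = exp (real k) / 4"
    using assms by (simp add: mesh_def powr_add[symmetric])
  finally show "block_time \<alpha> k l \<le> exp (real k)" by (simp add: block_time_def)
  show "3 / 4 * exp (real k) \<le> block_time \<alpha> k l" by (simp add: block_time_def mesh_def)
qed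

context correlation_decay begin

text \<open>Blocks are separated by gaps comparable with the larger of their times, so the correlation is small
compared with the inverse square of the larger level. The constant is taken as an \<open>m\<close>th root
because the estimate for one copy is raised to the power \<open>m\<close>.\<close>

lemma joint_tail_far_blocks:
  assumes m: "1 \<le> m" and "0 < \<epsilon>"
  shows "\<exists>k0. \<forall>k\<ge>k0. \<forall>j>k. \<forall>l<block_size \<alpha> k. \<forall>l'<block_size \<alpha> j.
    prob {\<omega>\<in>space N. block_level \<alpha> m k \<le> X (block_time \<alpha> k l) \<omega> \<and>
                      block_level \<alpha> m j \<le> X (block_time \<alpha> j l') \<omega>} ^ m
    \<le> (1 + \<epsilon>) * (normal_tail (block_level \<alpha> m k) ^ m * normal_tail (block_level \<alpha> m j) ^ m)"
proof -
  define \<delta> where "\<delta> = root m (1 + \<epsilon>) - 1"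
  have "1 < root m (1 + \<epsilon>)" using m \<open>0 < \<epsilon>\<close> by simp
  then have \<delta>: "0 < \<delta>" "(1 + \<delta>) ^ m = 1 + \<epsilon>"
    using m \<open>0 < \<epsilon>\<close> by (auto simp: \<delta>_def)
  obtain L0 \<eta>0 where far: "1 \<le> L0" "0 < \<eta>0"
    "\<And>L u v r. L0 \<le> L \<Longrightarrow> 1 \<le> u \<Longrightarrow> u \<le> L \<Longrightarrow> 1 \<le> v \<Longrightarrow> v \<le> L \<Longrightarrow> \<bar>r\<bar> * L\<^sup>2 \<le> \<eta>0 \<Longrightarrow>
       3 * \<bar>r\<bar> * L \<le> v \<and>
       normal_tail u * normal_tail (v - 3 * \<bar>r\<bar> * L) + normal_tail (3 * L)
       \<le> (1 + \<delta>) * (normal_tail u * normal_tail v)"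
    using far_tail_bound[OF \<delta>(1)] by metis
  have quarter: "0 < (1 / 4 :: real)" by simp
  have "\<forall>\<^sub>F k in sequentially. 1 \<le> k \<and> 1 \<le> block_level \<alpha> m k \<and> L0 \<le> block_level \<alpha> m k \<and>
      (block_level \<alpha> m k)\<^sup>2 \<le> 3 * real k / real m \<and>
      (\<forall>h\<ge>1 / 4 * exp (1 * real k). \<bar>\<rho> h\<bar> * (3 * real k / real m) \<le> \<eta>0)"
    using eventually_ge_at_top[of 1] block_level_ge_1[OF m, of \<alpha>] block_level_large[OF m, of L0]
      block_level_square[OF m, of \<alpha>] corr_far_small[OF far(2) zero_less_one quarter, of m]
    by eventually_elim blast
  then obtain k0 where k0: "\<And>k. k0 \<le> k \<Longrightarrow> 1 \<le> k \<and> 1 \<le> block_level \<alpha> m k \<and> L0 \<le> block_level \<alpha> m k \<and>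
      (block_level \<alpha> m k)\<^sup>2 \<le> 3 * real k / real m \<and>
      (\<forall>h\<ge>1 / 4 * exp (1 * real k). \<bar>\<rho> h\<bar> * (3 * real k / real m) \<le> \<eta>0)"
    unfolding eventually_sequentially by blast
  show ?thesis
  proof (intro exI[of _ k0] allI impI)
    fix k j l l' assume kj: "k0 \<le> k" "k < j" and l: "l < block_size \<alpha> k" "l' < block_size \<alpha> j"
    define u v s t where "u = block_level \<alpha> m k" and "v = block_level \<alpha> m j"
      and "s = block_time \<alpha> k l" and "t = block_time \<alpha> j l'"
    have K: "1 \<le> k" "1 \<le> u" "u\<^sup>2 \<le> 3 * real k / real m"
      using k0[of k] kj by (auto simp: u_def)
    have J: "1 \<le> j" "1 \<le> v" "L0 \<le> v" "v\<^sup>2 \<le> 3 * real j / real m"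
      "\<And>h. 1 / 4 * exp (real j) \<le> h \<Longrightarrow> \<bar>\<rho> h\<bar> * (3 * real j / real m) \<le> \<eta>0"
      using k0[of j] kj by (auto simp: v_def)
    define L where "L = sqrt (3 * real j / real m)"
    have L2: "L\<^sup>2 = 3 * real j / real m" by (simp add: L_def)
    have "0 \<le> L" by (simp add: L_def)
    have "v \<le> L" using J(4) unfolding L_def by (rule real_le_rsqrt)
    have "3 * real k / real m \<le> 3 * real j / real m"
      using kj by (intro divide_right_mono) auto
    with K(3) have "u \<le> L" unfolding L_def by (intro real_le_rsqrt) linarith
    have "s \<le> exp (real k)" "3 / 4 * exp (real k) \<le> s"
      unfolding s_def using block_time_bounds[OF \<alpha>_pos K(1) l(1)] by auto
    moreover have "2 * exp (real k) \<le> exp (real j)"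
    proof -
      have "2 * exp (real k) \<le> exp 1 * exp (real k)"
        using exp_ge_add_one_self[of "1 :: real"] by (intro mult_right_mono) auto
      also have "\<dots> = exp (1 + real k)" by (simp add: exp_add)
      also have "\<dots> \<le> exp (real j)" using kj by simp
      finally show ?thesis .
    qed
    moreover have "3 / 4 * exp (real j) \<le> t"
      unfolding t_def using block_time_bounds[OF \<alpha>_pos J(1) l(2)] by auto
    ultimately have gap: "1 / 4 * exp (real j) \<le> t - s" and "0 \<le> s"
      using exp_gt_zero[of "real k"] by linarith+
    then have st: "0 < t - s" using exp_gt_zero[of "real j"] by linarith
    have "\<bar>\<rho> \<bar>t - s\<bar>\<bar> * L\<^sup>2 \<le> \<eta>0" using J(5)[of "t - s"] gap st L2 by simp
    note f = far(3)[OF order_trans[OF J(3) \<open>v \<le> L\<close>] K(2) \<open>u \<le> L\<close> J(2) \<open>v \<le> L\<close> this]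
    have "prob {\<omega>\<in>space N. u \<le> X s \<omega> \<and> v \<le> X t \<omega>}
      \<le> normal_tail u * normal_tail (v - 3 * \<bar>\<rho> \<bar>t - s\<bar>\<bar> * L) + normal_tail (3 * L)"
      using f st \<open>0 \<le> s\<close> \<open>0 \<le> L\<close> K(2) corr_lt_1[of "\<bar>t - s\<bar>"] by (intro pair_tail_far) auto
    also have "\<dots> \<le> (1 + \<delta>) * (normal_tail u * normal_tail v)" using f by blast
    finally have "prob {\<omega>\<in>space N. u \<le> X s \<omega> \<and> v \<le> X t \<omega>} ^ m
        \<le> ((1 + \<delta>) * (normal_tail u * normal_tail v)) ^ m"
      by (intro power_mono) auto
    also have "\<dots> = (1 + \<epsilon>) * (normal_tail u ^ m * normal_tail v ^ m)"
      by (simp add: power_mult_distrib \<delta>(2))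
    finally show "prob {\<omega>\<in>space N. block_level \<alpha> m k \<le> X (block_time \<alpha> k l) \<omega> \<and>
          block_level \<alpha> m j \<le> X (block_time \<alpha> j l') \<omega>} ^ m
      \<le> (1 + \<epsilon>) * (normal_tail (block_level \<alpha> m k) ^ m * normal_tail (block_level \<alpha> m j) ^ m)"
      by (simp only: u_def v_def s_def t_def)
  qed
qed

lemma joint_tail_same_block:
  assumes m: "1 \<le> m"
  obtains B where
    "\<forall>\<^sub>F k in sequentially. \<forall>l<block_size \<alpha> k.
       (\<Sum>l'<block_size \<alpha> k. prob {\<omega>\<in>space N. block_level \<alpha> m k \<le> X (block_time \<alpha> k l) \<omega> \<and>
                      block_level \<alpha> m k \<le> X (block_time \<alpha> k l') \<omega>} ^ m)
       \<le> B * normal_tail (block_level \<alpha> m k) ^ m"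
proof -
  obtain S where S: "0 \<le> S"
    "\<forall>\<^sub>F k in sequentially. (\<Sum>d\<in>{1..<block_size \<alpha> k}. pair_weight m k d) \<le> S"
    using pair_weight_sum[OF m] .
  let ?A = "exp (3 / 2 :: real) ^ m"
  show ?thesis
  proof (rule that)
    show "\<forall>\<^sub>F k in sequentially. \<forall>l<block_size \<alpha> k.
       (\<Sum>l'<block_size \<alpha> k. prob {\<omega>\<in>space N. block_level \<alpha> m k \<le> X (block_time \<alpha> k l) \<omega> \<and>
                      block_level \<alpha> m k \<le> X (block_time \<alpha> k l') \<omega>} ^ m)
       \<le> (1 + ?A * (2 * S)) * normal_tail (block_level \<alpha> m k) ^ m"
      using S(2) block_pair_bound[OF m]
    proof eventually_elim
      case (elim k)
      define n v p where "n = block_size \<alpha> k" and "v = block_level \<alpha> m k" and "p = normal_tail v ^ m"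
      define Q where "Q = (\<lambda>l l'. prob {\<omega>\<in>space N. v \<le> X (block_time \<alpha> k l) \<omega> \<and>
                      v \<le> X (block_time \<alpha> k l') \<omega>} ^ m)"
      have p0: "0 \<le> p" by (simp add: p_def normal_tail_nonneg)
      have time0: "0 \<le> block_time \<alpha> k l" for l by (simp add: block_time_def mesh_def)
      have w0: "0 \<le> pair_weight m k d" for d
        unfolding pair_weight_def by (intro add_nonneg_nonneg) (auto simp: normal_tail_nonneg)
      have offd: "Q l l' \<le> ?A * p * pair_weight m k ((l' - l) + (l - l'))" if "l \<noteq> l'" for l l'
      proof -
        have "\<bar>block_time \<alpha> k l' - block_time \<alpha> k l\<bar> = \<bar>(real l' - real l) * mesh \<alpha> k\<bar>"
          by (simp add: block_time_def algebra_simps)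
        also have "\<dots> = \<bar>real l' - real l\<bar> * mesh \<alpha> k"
          unfolding abs_mult by (simp add: mesh_def)
        also have "\<bar>real l' - real l\<bar> = real ((l' - l) + (l - l'))"
          by (cases "l \<le> l'") (auto simp: of_nat_diff)
        finally have dist: "\<bar>block_time \<alpha> k l' - block_time \<alpha> k l\<bar> = real ((l' - l) + (l - l')) * mesh \<alpha> k" .
        have "1 \<le> (l' - l) + (l - l')" using that by linarith
        from elim(2)[rule_format, OF this time0 time0 dist]
        show ?thesis by (simp only: Q_def p_def v_def)
      qed
      have diag: "Q l l = p" for l
        using tail[OF time0, of v l] by (simp add: Q_def p_def)
      have "(\<Sum>l'<n. Q l l') \<le> (1 + ?A * (2 * S)) * p" if "l < n" for l
      proof -
        have "(\<Sum>l'<n. Q l l') = Q l l + (\<Sum>l'\<in>{..<n} - {l}. Q l l')"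
          using that by (intro sum.remove) auto
        also have "(\<Sum>l'\<in>{..<n} - {l}. Q l l')
          \<le> (\<Sum>l'\<in>{..<n} - {l}. ?A * p * pair_weight m k ((l' - l) + (l - l')))"
          by (intro sum_mono offd) auto
        also have "\<dots> = ?A * p * (\<Sum>l'\<in>{..<n} - {l}. pair_weight m k ((l' - l) + (l - l')))"
          by (simp only: sum_distrib_left)
        also have "\<dots> \<le> ?A * p * (2 * S)"
        proof (intro mult_left_mono)
          have "(\<Sum>l'\<in>{..<n} - {l}. pair_weight m k ((l' - l) + (l - l'))) \<le> 2 * (\<Sum>d\<in>{1..<n}. pair_weight m k d)"
            using w0 that by (rule sum_nat_distance_le)
          also have "\<dots> \<le> 2 * S" using elim(1) by (simp only: n_def)
          finally show "(\<Sum>l'\<in>{..<n} - {l}. pair_weight m k ((l' - l) + (l - l'))) \<le> 2 * S" .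
        qed (use p0 in auto)
        finally show ?thesis by (simp add: diag algebra_simps)
      qed
      then show ?case unfolding Q_def p_def n_def v_def by blast
    qed
  qed
qed

lemma blocks_exceed_infinitely_often:
  fixes M :: "'a measure" and Xs :: "'i \<Rightarrow> real \<Rightarrow> 'a \<Rightarrow> real"
  assumes "prob_space M"
    and pair: "\<And>s t u v. 0 \<le> s \<Longrightarrow> 0 \<le> t \<Longrightarrow>
        measure M {\<omega>\<in>space M. \<forall>j\<in>K. u \<le> Xs j s \<omega> \<and> v \<le> Xs j t \<omega>}
        = prob {\<omega>\<in>space N. u \<le> X s \<omega> \<and> v \<le> X t \<omega>} ^ m"
    and meas: "\<And>j t. j \<in> K \<Longrightarrow> 0 \<le> t \<Longrightarrow> Xs j t \<in> borel_measurable M"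
    and "finite K" and m: "1 \<le> m"
  shows "AE \<omega> in M. \<exists>\<^sub>F k in sequentially. \<exists>l<block_size \<alpha> k. \<forall>j\<in>K.
           block_level \<alpha> m k \<le> Xs j (block_time \<alpha> k l) \<omega>"
proof -
  interpret M: prob_space M by fact
  define E where "E = (\<lambda>k l. {\<omega>\<in>space M. \<forall>j\<in>K. block_level \<alpha> m k \<le> Xs j (block_time \<alpha> k l) \<omega>})"
  define Z where "Z = (\<lambda>k \<omega>. \<Sum>l<block_size \<alpha> k. indicator (E k l) \<omega> :: real)"
  have time0: "0 \<le> block_time \<alpha> k l" for k l by (simp add: block_time_def mesh_def)
  have E_meas [measurable]: "E k l \<in> sets M" for k l
  proof -
    have [measurable]: "Xs j (block_time \<alpha> k l) \<in> borel_measurable M" if "j \<in> K" for j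
      using meas[OF that time0] .
    show ?thesis unfolding E_def using \<open>finite K\<close> by measurable
  qed
  have inter: "M.prob (E k l \<inter> E j l') =
      prob {\<omega>\<in>space N. block_level \<alpha> m k \<le> X (block_time \<alpha> k l) \<omega> \<and>
                      block_level \<alpha> m j \<le> X (block_time \<alpha> j l') \<omega>} ^ m" for k l j l'
  proof -
    have "E k l \<inter> E j l' = {\<omega>\<in>space M. \<forall>i\<in>K. block_level \<alpha> m k \<le> Xs i (block_time \<alpha> k l) \<omega> \<and>
         block_level \<alpha> m j \<le> Xs i (block_time \<alpha> j l') \<omega>}"
      by (auto simp: E_def)
    then show ?thesis using pair[OF time0 time0] by simp
  qed
  have single: "M.prob (E k l) = normal_tail (block_level \<alpha> m k) ^ m" for k l
    using inter[of k l k l] tail[OF time0, of "block_level \<alpha> m k" k l] by simp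
  have Z_int: "integrable M (Z k)" for k
    unfolding Z_def by (intro Bochner_Integration.integrable_sum) (simp add: M.emeasure_eq_measure)
  have Z_exp: "M.expectation (Z k) = real (block_size \<alpha> k) * normal_tail (block_level \<alpha> m k) ^ m" for k
    unfolding Z_def
    by (subst Bochner_Integration.integral_sum) (auto simp: M.emeasure_eq_measure single)
  have ZZ: "Z k \<omega> * Z j \<omega> = (\<Sum>l<block_size \<alpha> k. \<Sum>l'<block_size \<alpha> j. indicator (E k l \<inter> E j l') \<omega>)" for k j \<omega>
    unfolding Z_def sum_product by (simp add: indicator_inter_arith)
  have ZZ_int: "integrable M (\<lambda>\<omega>. Z k \<omega> * Z j \<omega>)" for k j
    unfolding ZZ by (intro Bochner_Integration.integrable_sum) (simp add: M.emeasure_eq_measure)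
  have ZZ_exp: "M.expectation (\<lambda>\<omega>. Z k \<omega> * Z j \<omega>) =
      (\<Sum>l<block_size \<alpha> k. \<Sum>l'<block_size \<alpha> j. M.prob (E k l \<inter> E j l'))" for k j
    unfolding ZZ
    by (subst Bochner_Integration.integral_sum, simp add: M.emeasure_eq_measure)+
       (simp add: M.emeasure_eq_measure)
  obtain B where B: "\<forall>\<^sub>F k in sequentially. \<forall>l<block_size \<alpha> k.
       (\<Sum>l'<block_size \<alpha> k. M.prob (E k l \<inter> E k l')) \<le> B * normal_tail (block_level \<alpha> m k) ^ m"
    using joint_tail_same_block[OF m] unfolding inter by blast
  have "AE \<omega> in M. \<exists>\<^sub>F k in sequentially. Z k \<omega> \<noteq> 0"
  proof (rule M.infinitely_often_by_second_moment)
    show "Z k \<in> borel_measurable M" for k using Z_int by blast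
    show "0 \<le> Z k \<omega>" for k \<omega> by (simp add: Z_def sum_nonneg)
    show "integrable M (Z k)" for k by (rule Z_int)
    show "integrable M (\<lambda>\<omega>. Z k \<omega> * Z j \<omega>)" for k j by (rule ZZ_int)
    show "\<not> summable (\<lambda>k. M.expectation (Z k))"
      unfolding Z_exp by (rule block_expectation_bounds(1)[OF m \<alpha>_pos])
    show "\<forall>\<^sub>F k in sequentially. M.expectation (\<lambda>\<omega>. Z k \<omega> * Z k \<omega>) \<le> B * M.expectation (Z k)"
      using B
    proof eventually_elim
      case (elim k)
      have "M.expectation (\<lambda>\<omega>. Z k \<omega> * Z k \<omega>)
        \<le> (\<Sum>l<block_size \<alpha> k. B * normal_tail (block_level \<alpha> m k) ^ m)"
        unfolding ZZ_exp using elim by (intro sum_mono) auto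
      then show ?case by (simp add: Z_exp mult_ac)
    qed
    fix \<epsilon> :: real assume "0 < \<epsilon>"
    from joint_tail_far_blocks[OF m this] obtain k0 where k0: "\<And>k j l l'. k0 \<le> k \<Longrightarrow> k < j \<Longrightarrow>
        l < block_size \<alpha> k \<Longrightarrow> l' < block_size \<alpha> j \<Longrightarrow> M.prob (E k l \<inter> E j l')
        \<le> (1 + \<epsilon>) * (normal_tail (block_level \<alpha> m k) ^ m * normal_tail (block_level \<alpha> m j) ^ m)"
      unfolding inter by blast
    show "\<exists>k0. \<forall>k\<ge>k0. \<forall>j>k. M.expectation (\<lambda>\<omega>. Z k \<omega> * Z j \<omega>)
        \<le> (1 + \<epsilon>) * (M.expectation (Z k) * M.expectation (Z j))"
    proof (intro exI[of _ k0] allI impI)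
      fix k j assume "k0 \<le> k" "k < j"
      have "M.expectation (\<lambda>\<omega>. Z k \<omega> * Z j \<omega>) \<le> (\<Sum>l<block_size \<alpha> k. \<Sum>l'<block_size \<alpha> j.
          (1 + \<epsilon>) * (normal_tail (block_level \<alpha> m k) ^ m * normal_tail (block_level \<alpha> m j) ^ m))"
        unfolding ZZ_exp using \<open>k0 \<le> k\<close> \<open>k < j\<close> by (intro sum_mono k0) auto
      then show "M.expectation (\<lambda>\<omega>. Z k \<omega> * Z j \<omega>)
        \<le> (1 + \<epsilon>) * (M.expectation (Z k) * M.expectation (Z j))"
        by (simp add: Z_exp mult_ac)
    qed
  qed
  then show ?thesis
  proof eventually_elim
    case (elim \<omega>)
    then show ?case
    proof (rule frequently_elim1)
      fix k assume "Z k \<omega> \<noteq> 0"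
      then obtain l where "l < block_size \<alpha> k" "indicator (E k l) \<omega> \<noteq> (0 :: real)"
        unfolding Z_def by (meson lessThan_iff sum.not_neutral_contains_not_neutral)
      then show "\<exists>l<block_size \<alpha> k. \<forall>j\<in>K. block_level \<alpha> m k \<le> Xs j (block_time \<alpha> k l) \<omega>"
        by (auto simp: E_def indicator_eq_0_iff)
    qed
  qed
qed

end

section \<open>Order statistics and last exceedances\<close>

lemma sorted_nth_ge:
  fixes xs :: "'a :: linorder list"
  assumes "i < length xs" "card {j. j < length xs \<and> xs ! j < u} \<le> i"
  shows "u \<le> sort xs ! i"
proof (rule ccontr)
  assume "\<not> u \<le> sort xs ! i"
  then have "sort xs ! j < u" if "j \<le> i" for j
    using sorted_nth_mono[OF sorted_sort, of j i xs] that assms(1) by simp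
  then have "{..i} \<subseteq> {j. j < length (sort xs) \<and> sort xs ! j < u}"
    using assms(1) by auto
  then have "card {..i} \<le> card {j. j < length (sort xs) \<and> sort xs ! j < u}"
    by (intro card_mono) auto
  also have "\<dots> = length (filter (\<lambda>x. x < u) (sort xs))"
    by (simp add: length_filter_conv_card)
  also have "\<dots> = length (filter (\<lambda>x. x < u) xs)"
    by (metis filter_sort length_sort)
  also have "\<dots> \<le> i"
    using assms(2) by (simp add: length_filter_conv_card)
  finally show False by simp
qed

lemma order_stat_ge:
  assumes "1 \<le> r" "r \<le> n" "\<And>j. j \<in> {1..n - r + 1} \<Longrightarrow> u \<le> Xs j t \<omega>"
  shows "u \<le> order_stat r n Xs t \<omega>"
proof -
  let ?xs = "map (\<lambda>j. Xs j t \<omega>) [1..<n + 1]"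
  have "{j. j < length ?xs \<and> ?xs ! j < u} \<subseteq> {n - r + 1..<n}"
  proof
    fix j assume "j \<in> {j. j < length ?xs \<and> ?xs ! j < u}"
    then have "j < n" "Xs (Suc j) t \<omega> < u" by (auto simp: nth_append simp del: upt_Suc)
    moreover from this have "Suc j \<notin> {1..n - r + 1}"
      using assms(3)[of "Suc j"] by fastforce
    ultimately show "j \<in> {n - r + 1..<n}" by simp
  qed
  then have "card {j. j < length ?xs \<and> ?xs ! j < u} \<le> card {n - r + 1..<n}"
    by (intro card_mono) auto
  also have "\<dots> = r - 1" using assms by simp
  finally show ?thesis
    unfolding order_stat_def using assms by (intro sorted_nth_ge) auto
qed

lemma last_exceedance_unbounded:
  fixes f y :: "real \<Rightarrow> real"
  assumes unbdd: "\<And>T. \<exists>s\<ge>T. s0 \<le> s \<and> f s \<le> y s"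
  shows "filterlim (last_exceedance f s0 y) at_top at_top"
    and "Limsup at_top (\<lambda>t. ereal (last_exceedance f s0 y t - t)) = 0"
proof -
  let ?S = "\<lambda>t. {s. s0 \<le> s \<and> s \<le> t \<and> y s \<ge> f s}"
  have ge: "s \<le> last_exceedance f s0 y t" if "s0 \<le> s" "s \<le> t" "f s \<le> y s" for s t
  proof -
    have "s \<in> ?S t" using that by simp
    moreover have "s \<le> Sup (?S t)"
      using that by (intro cSup_upper) (auto intro: bdd_aboveI[where M = t])
    ultimately show ?thesis by (auto simp: last_exceedance_def Let_def)
  qed
  have le: "last_exceedance f s0 y t \<le> t" if "0 \<le> t" for t
  proof (cases "?S t = {}")
    case False
    then have "Sup (?S t) \<le> t" by (intro cSup_least) auto
    with False show ?thesis by (auto simp: last_exceedance_def Let_def)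
  qed (use that in \<open>simp add: last_exceedance_def Let_def\<close>)
  show "filterlim (last_exceedance f s0 y) at_top at_top"
    unfolding filterlim_at_top
  proof
    fix B
    obtain s where s: "B \<le> s" "s0 \<le> s" "f s \<le> y s" using unbdd by blast
    show "\<forall>\<^sub>F t in at_top. B \<le> last_exceedance f s0 y t"
      using eventually_ge_at_top[of s]
    proof eventually_elim
      case (elim t)
      then show ?case using ge[of s t] s by linarith
    qed
  qed
  show "Limsup at_top (\<lambda>t. ereal (last_exceedance f s0 y t - t)) = 0"
  proof (rule antisym)
    show "Limsup at_top (\<lambda>t. ereal (last_exceedance f s0 y t - t)) \<le> 0"
    proof (rule Limsup_bounded)
      show "\<forall>\<^sub>F t in at_top. ereal (last_exceedance f s0 y t - t) \<le> 0"
        using eventually_ge_at_top[of 0] by eventually_elim (use le in simp)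
    qed
    show "0 \<le> Limsup at_top (\<lambda>t. ereal (last_exceedance f s0 y t - t))"
    proof (rule ccontr)
      assume "\<not> ?thesis"
      then have "\<forall>\<^sub>F t in at_top. ereal (last_exceedance f s0 y t - t) < 0"
        by (intro Limsup_lessD) simp
      then obtain T where T: "\<And>t. T \<le> t \<Longrightarrow> ereal (last_exceedance f s0 y t - t) < 0"
        unfolding eventually_at_top_linorder by blast
      obtain s where s: "T \<le> s" "s0 \<le> s" "f s \<le> y s" using unbdd by blast
      then show False using T[of s] ge[of s s] by simp
    qed
  qed
qed

section \<open>The theorem\<close>

lemma (in stationary_gaussian) correlation_decay_exists:
  assumes \<alpha>: "0 < \<alpha>" and "0 < C" and "0 < lam"
    and near: "(\<lambda>t. \<rho> t - (1 - C * \<bar>t\<bar> powr \<alpha>)) \<in> o[at_right 0](\<lambda>t. \<bar>t\<bar> powr \<alpha>)"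
    and sup: "\<And>s. s > 0 \<Longrightarrow> (SUP t\<in>{s..}. \<bar>\<rho> t\<bar>) < 1"
    and far: "\<rho> \<in> O[at_top](\<lambda>t. t powr (- 2 * lam))"
  obtains h0 \<kappa> D T0 where "correlation_decay N X \<alpha> (C / 2) h0 \<kappa> D T0 lam"
proof -
  have sup_le: "\<bar>\<rho> t\<bar> \<le> (SUP t\<in>{s..}. \<bar>\<rho> t\<bar>)" if "0 < s" "s \<le> t" for s t
    using that correlation_le_1
    by (intro cSUP_upper) (auto intro!: bdd_aboveI2[where M = 1])
  have "\<forall>\<^sub>F t in at_right 0. norm (\<rho> t - (1 - C * \<bar>t\<bar> powr \<alpha>)) \<le> C / 2 * norm (\<bar>t\<bar> powr \<alpha>)"
    using landau_o.smallD[OF near, of "C / 2"] \<open>0 < C\<close> by simp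
  then obtain h0 where h0: "0 < h0"
    "\<And>t. 0 < t \<Longrightarrow> t < h0 \<Longrightarrow> \<bar>\<rho> t - (1 - C * t powr \<alpha>)\<bar> \<le> C / 2 * t powr \<alpha>"
    by (auto simp: eventually_at_right_field)
  from far obtain D where D: "0 < D"
    "\<forall>\<^sub>F t in at_top. norm (\<rho> t) \<le> D * norm (t powr (- 2 * lam))"
    by (rule landau_o.bigE)
  then obtain T0 where T0: "\<And>t. T0 \<le> t \<Longrightarrow> \<bar>\<rho> t\<bar> \<le> D * t powr (- 2 * lam)"
    by (auto simp: eventually_at_top_linorder)
  define \<kappa> where "\<kappa> = 1 - (SUP t\<in>{h0..}. \<bar>\<rho> t\<bar>)"
  have "correlation_decay N X \<alpha> (C / 2) h0 \<kappa> D T0 lam"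
  proof unfold_locales
    show "0 < \<alpha>" "0 < C / 2" "0 < h0" "0 < D" "0 < lam" using assms h0 D by auto
    show "0 < \<kappa>" using sup[OF h0(1)] by (simp add: \<kappa>_def)
    show "\<bar>\<rho> h\<bar> < 1" if "0 < h" for h
      using sup_le[OF that order_refl] sup[OF that] by linarith
    show "C / 2 * h powr \<alpha> \<le> 1 - \<rho> h" if "0 < h" "h < h0" for h
      using abs_le_D1[OF h0(2)[OF that]] by (simp add: field_simps)
    show "\<kappa> \<le> 1 - \<rho> h" if "h0 \<le> h" for h
      using sup_le[OF h0(1) that] by (simp add: \<kappa>_def)
    show "\<bar>\<rho> h\<bar> \<le> D * h powr (- 2 * lam)" if "T0 \<le> h" for h
      using T0[OF that] .
  qed
  then show ?thesis by (rule that)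
qed

lemma level_fun_le_block_level:
  assumes "0 \<le> p" "1 \<le> k"
  shows "level_fun \<alpha> r n p (exp (real k)) \<le> block_level \<alpha> (n - r + 1) k"
proof -
  define m where "m = n - r + 1"
  have "0 \<le> ln (real k)" using assms by simp
  then have "((2 - real m * \<alpha>) / (2 * \<alpha>) + 1 - p) * ln (real k)
      \<le> ((2 - real m * \<alpha>) / (2 * \<alpha>) + 1) * ln (real k)"
    using assms by (intro mult_right_mono) auto
  then show ?thesis
    unfolding level_fun_def block_level_def Let_def m_def[symmetric]
    by (auto intro!: real_sqrt_le_mono mult_left_mono divide_right_mono)
qed

theorem mainTheorem4:
  fixes N :: "'b measure" and X :: "real \<Rightarrow> 'b \<Rightarrow> real"
    and M :: "'a measure" and Xs :: "nat \<Rightarrow> real \<Rightarrow> 'a \<Rightarrow> real"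
    and \<alpha> C lam p sp :: real and n r :: nat
  assumes "prob_space N" and "prob_space M"
    and "gaussian_process N X" and "stationary_process N X" and "as_continuous_paths N X"
    and "\<And>t. t \<ge> 0 \<Longrightarrow> (\<integral>\<omega>. X t \<omega> \<partial>N) = 0"
    and "\<And>t. t \<ge> 0 \<Longrightarrow> (\<integral>\<omega>. (X t \<omega>)\<^sup>2 \<partial>N) = 1"
    and "0 < \<alpha>" and "\<alpha> \<le> 2" and "C > 0"
    and "(\<lambda>t. corr_fun N X t - (1 - C * \<bar>t\<bar> powr \<alpha>)) \<in> o[at_right 0](\<lambda>t. \<bar>t\<bar> powr \<alpha>)"
    and "\<And>s. s > 0 \<Longrightarrow> (SUP t\<in>{s..}. \<bar>corr_fun N X t\<bar>) < 1"
    and "lam > 0" and "corr_fun N X \<in> O[at_top](\<lambda>t. t powr (- 2 * lam))"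
    and "1 \<le> r" and "r \<le> n"
    and "independent_copies M {1..n} Xs N X"
    and "sp > exp 1"
    and "\<And>s. s \<ge> sp \<Longrightarrow> level_fun \<alpha> r n p s > 0"
    and "mono_on {sp..} (level_fun \<alpha> r n p)"
    and "p \<ge> 0"
  defines "\<xi> \<equiv> \<lambda>t \<omega>. last_exceedance (level_fun \<alpha> r n p) sp (\<lambda>s. order_stat r n Xs s \<omega>) t"
  shows "(AE \<omega> in M. filterlim (\<lambda>t. \<xi> t \<omega>) at_top at_top) \<and>
         (AE \<omega> in M. Limsup at_top (\<lambda>t. ereal (\<xi> t \<omega> - t)) = 0)"
proof -
  interpret stationary_gaussian N X
    using assms(1,3,4,6,7) by (simp add: stationary_gaussian_def stationary_gaussian_axioms_def)
  obtain h0 \<kappa> D T0 where decay: "correlation_decay N X \<alpha> (C / 2) h0 \<kappa> D T0 lam"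
    using correlation_decay_exists[OF assms(8,10,13,11,12,14)] .
  interpret correlation_decay N X \<alpha> "C / 2" h0 \<kappa> D T0 lam by fact
  define m where "m = n - r + 1"
  have sub: "{1..m} \<subseteq> {1..n}" and m: "1 \<le> m" using assms(15,16) by (auto simp: m_def)
  have "AE \<omega> in M. \<exists>\<^sub>F k in sequentially. \<exists>l<block_size \<alpha> k. \<forall>j\<in>{1..m}.
      block_level \<alpha> m k \<le> Xs j (block_time \<alpha> k l) \<omega>"
  proof (rule blocks_exceed_infinitely_often)
    fix s t u v :: real assume "0 \<le> s" "0 \<le> t"
    then show "measure M {\<omega>\<in>space M. \<forall>j\<in>{1..m}. u \<le> Xs j s \<omega> \<and> v \<le> Xs j t \<omega>}
        = prob {\<omega>\<in>space N. u \<le> X s \<omega> \<and> v \<le> X t \<omega>} ^ m"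
      using independent_copies_pair[OF assms(2,17) _ sub, of s t u v] m X_measurable by simp
  next
    fix j t assume "j \<in> {1..m}" "(0::real) \<le> t"
    then show "Xs j t \<in> borel_measurable M"
      using assms(17) sub by (auto simp: independent_copies_def)
  qed (use assms(2) m in auto)
  then have main: "AE \<omega> in M. \<forall>T. \<exists>s\<ge>T. sp \<le> s \<and> level_fun \<alpha> r n p s \<le> order_stat r n Xs s \<omega>"
  proof eventually_elim
    case (elim \<omega>)
    show ?case
    proof
      fix T
      have "filterlim (\<lambda>k :: nat. 3 / 4 * exp (real k)) at_top sequentially" by real_asymp
      then have "\<forall>\<^sub>F k :: nat in sequentially. max T sp \<le> 3 / 4 * exp (real k)"
        unfolding filterlim_at_top by blast
      then have "\<forall>\<^sub>F k :: nat in sequentially. 1 \<le> k \<and> max T sp \<le> 3 / 4 * exp (real k)"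
        using eventually_ge_at_top[of 1] by eventually_elim simp
      from frequently_ex[OF frequently_eventually_frequently[OF elim this]]
      obtain k l where kl: "l < block_size \<alpha> k" "1 \<le> k" "max T sp \<le> 3 / 4 * exp (real k)"
        and exc: "\<And>j. j \<in> {1..m} \<Longrightarrow> block_level \<alpha> m k \<le> Xs j (block_time \<alpha> k l) \<omega>" by blast
      define s where "s = block_time \<alpha> k l"
      have s: "3 / 4 * exp (real k) \<le> s" "s \<le> exp (real k)"
        unfolding s_def using block_time_bounds[OF \<open>0 < \<alpha>\<close> kl(2,1)] by auto
      then have "T \<le> s" "sp \<le> s" using kl(3) by auto
      have "level_fun \<alpha> r n p s \<le> level_fun \<alpha> r n p (exp (real k))"
        using \<open>sp \<le> s\<close> s(2) by (intro mono_onD[OF assms(20)]) auto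
      also have "\<dots> \<le> block_level \<alpha> m k"
        unfolding m_def using \<open>p \<ge> 0\<close> kl(2) by (rule level_fun_le_block_level)
      also have "\<dots> \<le> order_stat r n Xs s \<omega>"
        using assms(15,16) exc by (intro order_stat_ge) (auto simp: m_def s_def)
      finally show "\<exists>s\<ge>T. sp \<le> s \<and> level_fun \<alpha> r n p s \<le> order_stat r n Xs s \<omega>"
        using \<open>T \<le> s\<close> \<open>sp \<le> s\<close> by blast
    qed
  qed
  show ?thesis
  proof
    show "AE \<omega> in M. filterlim (\<lambda>t. \<xi> t \<omega>) at_top at_top"
      using main unfolding \<xi>_def by eventually_elim (rule last_exceedance_unbounded, blast)
    show "AE \<omega> in M. Limsup at_top (\<lambda>t. ereal (\<xi> t \<omega> - t)) = 0"
      using main unfolding \<xi>_def by eventually_elim (rule last_exceedance_unbounded, blast)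
  qed
qed

end
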